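(* Let $(\beta_n)_{n\ge 1}$ be a sequence of positive real numbers, write $\beta=\beta_n$, and assume that $\frac{\log n}{n}\ll\beta\ll\frac{1}{\log n}$. Let $\alpha=\alpha_n=\frac{n\beta}{2}$ and for each $n$ let $(\lambda_1,\ldots,\lambda_n)$ be distributed according to $P_{n,\alpha,\beta}$. Then $\lambda_{\max}:=\max_{i\le n}\lambda_i$ converges in probability to $2$ as $n\to\infty$.
   Context: For real sequences $u=u_n$, $v=v_n$, the notation $u\ll v$ means $u_n/v_n\to 0$ as $n\to\infty$. For $n\ge 1$ and $\alpha,\beta>0$, $P_{n,\alpha,\beta}$ is the probability measure on $\mathbb{R}^n$ (the Gaussian $\beta$-ensemble) $$P_{n,\alpha,\beta}(\mathrm{d}\lambda_1,\ldots,\mathrm{d}\lambda_n)=\frac{1}{Z_{n,\alpha,\beta}}\exp\Big(-\frac{\alpha}{2}\sum_{i=1}^n\lambda_i^2\Big)\prod_{1\le i<j\le n}|\lambda_i-\lambda_j|^{\beta}\prod_{i=1}^n\mathrm{d}\lambda_i,$$ where $Z_{n,\alpha,\beta}$ is the normalizing constant. *)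

theory Defs
  imports "HOL-Probability.Probability"
begin

definition much_less :: "(nat \<Rightarrow> real) \<Rightarrow> (nat \<Rightarrow> real) \<Rightarrow> bool" (infix "\<lless>" 50) where
  "u \<lless> v \<longleftrightarrow> (\<lambda>n. u n / v n) \<longlonglongrightarrow> 0"

text \<open>
  Since the dimension \<open>n\<close> varies, \<open>\<real>\<^sup>n\<close> is represented by the extensional
  functions \<open>{1..n} \<rightarrow>\<^sub>E UNIV\<close> with the product of \<open>n\<close> copies of Lebesgue measure
  on the Borel sets.
\<close>

abbreviation euclid :: "nat \<Rightarrow> (nat \<Rightarrow> real) measure" where
  "euclid n \<equiv> \<Pi>\<^sub>M i\<in>{1..n}. lborel"

definition gbe_weight :: "nat \<Rightarrow> real \<Rightarrow> real \<Rightarrow> (nat \<Rightarrow> real) \<Rightarrow> real" where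
  "gbe_weight n \<alpha> \<beta> x =
     exp (- (\<alpha> / 2) * (\<Sum>i=1..n. (x i)\<^sup>2)) *
     (\<Prod>(i, j)\<in>{(i, j). 1 \<le> i \<and> i < j \<and> j \<le> n}. \<bar>x i - x j\<bar> powr \<beta>)"

definition gbe_Z :: "nat \<Rightarrow> real \<Rightarrow> real \<Rightarrow> real" where
  "gbe_Z n \<alpha> \<beta> = (LINT x|euclid n. gbe_weight n \<alpha> \<beta> x)"

text \<open>
  The Gaussian \<open>\<beta>\<close>-ensemble. It is intended for \<open>\<alpha>, \<beta> > 0\<close> only:
  outside this range the Bochner integral \<open>gbe_Z\<close> may default to \<open>0\<close>.
\<close>

definition gbe :: "nat \<Rightarrow> real \<Rightarrow> real \<Rightarrow> (nat \<Rightarrow> real) measure" where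
  "gbe n \<alpha> \<beta> = density (euclid n) (\<lambda>x. ennreal (gbe_weight n \<alpha> \<beta> x / gbe_Z n \<alpha> \<beta>))"

text \<open>
  Convergence in probability to a constant; the \<open>n\<close>-th random variable may live on its
  own probability space \<open>M n\<close>.
\<close>

definition tendsto_in_prob ::
    "(nat \<Rightarrow> 'a measure) \<Rightarrow> (nat \<Rightarrow> 'a \<Rightarrow> real) \<Rightarrow> real \<Rightarrow> bool" where
  "tendsto_in_prob M Y c \<longleftrightarrow>
     (\<forall>\<epsilon>>0. (\<lambda>n. measure (M n) {\<omega> \<in> space (M n). \<bar>Y n \<omega> - c\<bar> > \<epsilon>}) \<longlonglongrightarrow> 0)"

end

theory Submission
  imports Defs "HOL-Real_Asymp.Real_Asymp"
begin

text \<open>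
  The proof computes moments. Put \<open>y\<^sub>i = \<lambda>\<^sub>i + 2\<close> and let \<open>p\<^sub>j\<close> be the mean of the \<open>y\<^sub>i ^ j\<close>. Integration by
  parts against the density of the ensemble, with the vector field \<open>y\<^sub>i ^ r F\<close> and \<open>F\<close> a
  product of power means, gives the loop equation (\<open>gbe_loop_system\<close>)

    \<open>E[p\<^sub>r\<^sub>+\<^sub>1 F] = 2 E[p\<^sub>r F] + (\<Sum>l<r. E[p\<^sub>l p\<^sub>r\<^sub>-\<^sub>1\<^sub>-\<^sub>l F]) + r \<gamma> E[p\<^sub>r\<^sub>-\<^sub>1 F] + \<delta> (\<dots>)\<close>,

  where \<open>\<gamma> = (2 / \<beta> - 1) / n\<close>, \<open>\<delta> = 2 / (n\<^sup>2 \<beta>)\<close>, and the dots are sums of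
  expectations in which \<open>p\<^sub>j\<close> in \<open>F\<close> is replaced by \<open>j p\<^sub>r\<^sub>+\<^sub>j\<^sub>-\<^sub>1\<close>. Every term on the right has smaller
  degree, so the equations determine all joint moments. The equations with \<open>\<gamma> = \<delta> = 0\<close> are solved by
  \<open>E[\<Prod> p\<^sub>j] = \<Prod> C\<^sub>j\<^sub>+\<^sub>1\<close> with the Catalan numbers \<open>C\<^sub>m\<close>, which are the moments of the semicircle law
  shifted to \<open>[0, 4]\<close>.

  The derivative of the interaction \<open>\<bar>\<lambda>\<^sub>i - \<lambda>\<^sub>j\<bar> powr \<beta>\<close> is singular for small \<open>\<beta>\<close>. The distances are therefore
  regularised first. After summation over \<open>i\<close> the singular forces combine to difference quotients of
  polynomials, and the regularisation can be removed by dominated convergence.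

  Lower bound for the maximum. As \<open>n\<close> tends to infinity, \<open>\<gamma>\<close> and \<open>\<delta>\<close> tend to zero, and all joint
  moments of fixed degree converge to the Catalan products (\<open>loop_system_tendsto\<close>). In particular the power means
  have vanishing variance. If all \<open>y\<^sub>i\<close> were below \<open>4 - \<epsilon>\<close>, then \<open>p\<^sub>k\<^sub>+\<^sub>1 \<le> (4 - \<epsilon>) p\<^sub>k\<close> for even \<open>k\<close>; but the ratio of the
  limits \<open>C\<^sub>k\<^sub>+\<^sub>2\<close> and \<open>C\<^sub>k\<^sub>+\<^sub>1\<close> tends to \<open>4\<close> (\<open>lower_tail\<close>).

  Upper bound for the maximum. A single eigenvalue is visible only in moments whose order is a large
  multiple of \<open>ln n\<close>. Since the coefficients of the loop equations are nonnegative (as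
  \<open>\<beta> \<le> 2\<close> eventually), induction on the degree gives \<open>E[p\<^sub>K] \<le> R ^ K C\<^sub>K\<^sub>+\<^sub>1\<close> as soon as the errors
  \<open>K \<gamma> + \<delta> K (K + 2)\<^sup>2\<close> are at most \<open>R - 1\<close> (\<open>loop_system_upper_bound\<close>). For
  \<open>K\<close> of order \<open>ln n\<close> these errors vanish for every \<open>R > 1\<close>, because \<open>ln n \<lless> n \<beta>\<close>. As
  \<open>C\<^sub>K\<^sub>+\<^sub>1 \<le> 4 ^ (K + 1)\<close>, Markov's inequality bounds the probability that some \<open>y\<^sub>i\<close> exceeds \<open>4 + \<epsilon>\<close> by
  \<open>4 n (4 R / (4 + \<epsilon>)) ^ K\<close>, which tends to zero for a suitable multiple \<open>K\<close> of \<open>ln n\<close> (\<open>upper_tail\<close>).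
\<close>

section \<open>Catalan numbers\<close>

text \<open>
  The recursion by ratios makes the growth rate \<open>4\<close> visible; this rate is the length of the
  interval \<open>[0, 4]\<close> on which the shifted eigenvalues concentrate. The convolution recursion, which is
  what the loop equations produce, is derived from it.
\<close>

fun catalan :: "nat \<Rightarrow> real" where
  "catalan 0 = 1"
| "catalan (Suc m) = (4 * real m + 2) / (real m + 2) * catalan m"

lemma catalan_pos: "catalan m > 0"
  by (induction m) auto

declare catalan.simps(2) [simp del]

lemma catalan_1 [simp]: "catalan (Suc 0) = 1"
  by (simp add: catalan.simps(2))

lemma catalan_ratio: "(real m + 2) * catalan (Suc m) = (4 * real m + 2) * catalan m"
  by (simp add: catalan.simps(2))

lemma catalan_Suc_le: "catalan (Suc m) \<le> 4 * catalan m"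
proof -
  have "(4 * real m + 2) / (real m + 2) \<le> 4" by (simp add: field_simps)
  from mult_right_mono[OF this, of "catalan m"] show ?thesis
    using catalan_pos[of m] by (simp add: catalan.simps(2))
qed

lemma catalan_le_Suc: "catalan m \<le> catalan (Suc m)"
proof -
  have "1 \<le> (4 * real m + 2) / (real m + 2)" by (simp add: field_simps)
  from mult_right_mono[OF this, of "catalan m"] show ?thesis
    using catalan_pos[of m] by (simp add: catalan.simps(2))
qed

lemma catalan_add_le: "catalan (k + m) \<le> 4 ^ k * catalan m"
proof (induction k)
  case (Suc k)
  then show ?case using catalan_Suc_le[of "k + m"] by simp
qed simp

lemma catalan_lower: "4 ^ m \<le> (real m + 1)\<^sup>2 * catalan m"
proof (induction m)
  case (Suc m)
  have "4 * (real m + 1)\<^sup>2 \<le> (real m + 2)\<^sup>2 * ((4 * real m + 2) / (real m + 2))"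
    by (simp add: field_simps power2_eq_square)
  then have "4 * (real m + 1)\<^sup>2 * catalan m \<le> (real m + 2)\<^sup>2 * ((4 * real m + 2) / (real m + 2)) * catalan m"
    using catalan_pos[of m] by (intro mult_right_mono) auto
  with Suc show ?case by (simp add: catalan.simps(2) mult.assoc add.commute)
qed simp

text \<open>
  Write \<open>S\<^sub>n\<close> for the convolution sum. By symmetry, weighting its terms with \<open>k + 1\<close> multiplies it by
  \<open>(n + 2) / 2\<close>; expanding the same weighted sum for \<open>n + 1\<close> with the ratio recursion expresses it
  through \<open>S\<^sub>n\<close>. Comparing both gives a first-order recursion for \<open>S\<^sub>n\<close>, the one of the Catalan
  numbers.
\<close>

lemma catalan_convolution: "(\<Sum>k\<le>n. catalan k * catalan (n - k)) = catalan (Suc n)"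
proof (induction n)
  case 0
  then show ?case by simp
next
  case (Suc n)
  define S where "S n = (\<Sum>k\<le>n. catalan k * catalan (n - k))" for n
  \<comment> \<open>Reversing the summation index symmetrises a linear weight.\<close>
  have sym: "(\<Sum>k\<le>n. real k * (catalan k * catalan (n - k))) = real n / 2 * S n" for n
  proof -
    let ?T = "\<Sum>k\<le>n. real k * (catalan k * catalan (n - k))"
    have "?T = (\<Sum>k\<le>n. real (n - k) * (catalan (n - k) * catalan (n - (n - k))))"
      by (subst sum.nat_diff_reindex[symmetric, where n = "Suc n", simplified lessThan_Suc_atMost])
         (simp add: sum.nat_diff_reindex)
    also have "\<dots> = (\<Sum>k\<le>n. (real n - real k) * (catalan k * catalan (n - k)))"
      by (intro sum.cong) (auto simp: of_nat_diff mult.commute)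
    also have "\<dots> = real n * S n - ?T"
      by (simp add: S_def sum_distrib_left left_diff_distrib sum_subtractf)
    finally show ?thesis by simp
  qed
  have "(real n + 3) / 2 * S (Suc n) = (\<Sum>k\<le>Suc n. (real k + 1) * (catalan k * catalan (Suc n - k)))"
    using sym[of "Suc n"] by (simp add: S_def distrib_right sum.distrib add_divide_distrib del: sum.atMost_Suc)
  also have "\<dots> = catalan (Suc n) + (\<Sum>k\<le>n. (real k + 2) * catalan (Suc k) * catalan (n - k))"
    by (subst sum.atMost_Suc_shift) (simp add: algebra_simps)
  also have "\<dots> = catalan (Suc n) + (\<Sum>k\<le>n. 4 * (real k * (catalan k * catalan (n - k))) + 2 * (catalan k * catalan (n - k)))"
    unfolding catalan_ratio by (simp add: algebra_simps)
  also have "\<dots> = catalan (Suc n) + (2 * real n + 2) * S n"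
    by (simp add: sum.distrib sum_distrib_left[symmetric] sym S_def[symmetric]) (simp add: algebra_simps)
  also have "\<dots> = (2 * real n + 3) * catalan (Suc n)"
    using Suc by (simp add: S_def algebra_simps)
  also have "\<dots> = (real n + 3) / 2 * catalan (Suc (Suc n))"
    using catalan_ratio[of "Suc n"] by (simp add: field_simps)
  finally show ?case by (simp add: S_def del: sum.atMost_Suc)
qed

text \<open>
  The two extreme terms of the convolution are split off: for \<open>f j = catalan (j + 1)\<close> this is the
  recursion \<open>f (r + 1) = 2 f r + (\<Sum>l<r. f l f (r - 1 - l))\<close>, the limiting loop equation.
\<close>

lemma catalan_shifted_convolution:
  "2 * catalan (Suc r) + (\<Sum>l<r. catalan (Suc l) * catalan (r - l)) = catalan (r + 2)"
proof -
  have "catalan (r + 2) = (\<Sum>k\<le>Suc r. catalan k * catalan (Suc r - k))"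
    by (simp only: catalan_convolution) simp
  also have "\<dots> = catalan (Suc r) + (\<Sum>k\<le>r. catalan (Suc k) * catalan (r - k))"
    by (subst sum.atMost_Suc_shift) simp
  also have "(\<Sum>k\<le>r. catalan (Suc k) * catalan (r - k)) =
     (\<Sum>l<r. catalan (Suc l) * catalan (r - l)) + catalan (Suc r)"
    by (simp add: lessThan_Suc_atMost[symmetric])
  finally show ?thesis by simp
qed

section \<open>The loop recursion\<close>

text \<open>
  Here \<open>W js\<close> stands for the expectation of a product of power means, one factor for each entry of
  \<open>js\<close>. The last equation expresses it by products of smaller total degree. The equations without
  the terms in \<open>\<gamma>\<close> and \<open>\<delta>\<close> are solved by products of Catalan numbers; \<open>\<gamma>\<close> measures the entropy of the particles and
  \<open>\<delta>\<close> the correlation between different power means.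
\<close>

definition loop_system :: "real \<Rightarrow> real \<Rightarrow> (nat list \<Rightarrow> real) \<Rightarrow> bool" where
  "loop_system \<gamma> \<delta> W \<longleftrightarrow> W [] = 1 \<and> (\<forall>js. W (0 # js) = W js) \<and>
     (\<forall>r js. W (Suc r # js) =
        2 * W (r # js) + (\<Sum>l<r. W (l # (r - 1 - l) # js)) + real r * \<gamma> * W ((r - 1) # js) +
        \<delta> * (\<Sum>s<length js. real (js ! s) * W (js[s := r + js ! s - 1])))"

lemma sum_list_update_nat:
  fixes js :: "nat list"
  assumes "s < length js"
  shows "sum_list (js[s := v]) + js ! s = sum_list js + v"
  using assms
proof (induction js arbitrary: s)
  case (Cons a js)
  then show ?case by (cases s) auto
qed simp

text \<open>
  Every term on the right-hand side of the loop recursion has smaller total degree than the left-hand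
  side, but splitting an entry in two makes the list longer, and leading zeros are removed without
  change of degree. The sum of total degree and length decreases in all cases; the bound on the
  total degree alone is recorded as well, since the estimates below hold only up to a given degree.
\<close>

lemma loop_induct [case_names Nil zero Suc]:
  assumes "P []"
    and "\<And>js. P js \<Longrightarrow> P (0 # js)"
    and "\<And>r js. (\<And>ks. sum_list ks \<le> r + sum_list js \<Longrightarrow> sum_list ks + length ks \<le> r + sum_list js + length js + 1 \<Longrightarrow> P ks)
       \<Longrightarrow> P (Suc r # js)"
  shows "P (js :: nat list)"
proof (induction js rule: measure_induct_rule[where f = "\<lambda>js. sum_list js + length js"])
  case (less js)
  show ?case
  proof (cases js)
    case Nil
    then show ?thesis using assms(1) by simp
  next
    case (Cons j ks)
    show ?thesis
    proof (cases j)
      case 0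
      then show ?thesis using Cons less[of ks] assms(2) by simp
    next
      case (Suc r)
      show ?thesis unfolding Cons Suc
        by (rule assms(3)) (rule less, simp add: Cons Suc)
    qed
  qed
qed

lemma loop_update_sum_le:
  assumes "s < length js" "js ! s \<noteq> (0::nat)"
  shows "sum_list (js[s := r + js ! s - 1]) \<le> r + sum_list js"
  using sum_list_update_nat[OF assms(1), of "r + js ! s - 1"] assms(2) by linarith

lemma loop_update_measure_le:
  assumes "s < length js" "js ! s \<noteq> (0::nat)"
  shows "sum_list (js[s := r + js ! s - 1]) + length (js[s := r + js ! s - 1]) \<le> r + sum_list js + length js + 1"
  using loop_update_sum_le[OF assms, of r] by simp

lemma prod_list_map_update:
  fixes f :: "nat \<Rightarrow> real"
  assumes "s < length js" "f (js ! s) \<noteq> 0"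
  shows "prod_list (map f (js[s := v])) = f v / f (js ! s) * prod_list (map f js)"
  using assms
proof (induction js arbitrary: s)
  case (Cons a js)
  then show ?case by (cases s) auto
qed simp

text \<open>
  Because the recursion is finite and closed for each list, it passes to the limit term by
  term, and in the limit it becomes the recursion of the Catalan products.
\<close>

lemma loop_system_tendsto:
  assumes W: "eventually (\<lambda>n. loop_system (\<gamma> n) (\<delta> n) (W n)) sequentially"
    and \<gamma>: "\<gamma> \<longlonglongrightarrow> 0" and \<delta>: "\<delta> \<longlonglongrightarrow> 0"
  shows "(\<lambda>n. W n js) \<longlonglongrightarrow> prod_list (map (\<lambda>j. catalan (Suc j)) js)"
proof (induction js rule: loop_induct)
  case Nil
  have "eventually (\<lambda>n. W n [] = 1) sequentially"
    using W by eventually_elim (simp add: loop_system_def)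
  then show ?case by (simp add: tendsto_eventually)
next
  case (zero js)
  have "eventually (\<lambda>n. W n (0 # js) = W n js) sequentially"
    using W by eventually_elim (simp add: loop_system_def)
  with zero show ?case by (simp add: tendsto_cong)
next
  case (Suc r js)
  let ?g = "\<lambda>js. prod_list (map (\<lambda>j. catalan (Suc j)) js)"
  have upd: "(\<lambda>n. real (js ! s) * W n (js[s := r + js ! s - 1])) \<longlonglongrightarrow> real (js ! s) * ?g (js[s := r + js ! s - 1])"
    if "s < length js" for s
  proof (cases "js ! s = 0")
    case False
    show ?thesis
      by (intro tendsto_mult tendsto_const Suc loop_update_sum_le loop_update_measure_le that False)
  qed simp
  have "(\<lambda>n. 2 * W n (r # js) + (\<Sum>l<r. W n (l # (r - 1 - l) # js)) + real r * \<gamma> n * W n ((r - 1) # js) +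
        \<delta> n * (\<Sum>s<length js. real (js ! s) * W n (js[s := r + js ! s - 1]))) \<longlonglongrightarrow>
     2 * ?g (r # js) + (\<Sum>l<r. ?g (l # (r - 1 - l) # js)) + real r * 0 * ?g ((r - 1) # js) +
        0 * (\<Sum>s<length js. real (js ! s) * ?g (js[s := r + js ! s - 1]))"
    by (intro tendsto_intros \<gamma> \<delta> upd Suc) auto
  also have "2 * ?g (r # js) + (\<Sum>l<r. ?g (l # (r - 1 - l) # js)) + real r * 0 * ?g ((r - 1) # js) +
        0 * (\<Sum>s<length js. real (js ! s) * ?g (js[s := r + js ! s - 1]))
     = (2 * catalan (Suc r) + (\<Sum>l<r. catalan (Suc l) * catalan (r - l))) * ?g js"
    by (simp add: distrib_right sum_distrib_right mult.assoc Suc_diff_Suc)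
  also have "\<dots> = ?g (Suc r # js)"
    by (simp only: catalan_shifted_convolution) simp
  finally have lim: "(\<lambda>n. 2 * W n (r # js) + (\<Sum>l<r. W n (l # (r - 1 - l) # js)) + real r * \<gamma> n * W n ((r - 1) # js) +
        \<delta> n * (\<Sum>s<length js. real (js ! s) * W n (js[s := r + js ! s - 1]))) \<longlonglongrightarrow> ?g (Suc r # js)" .
  have "eventually (\<lambda>n. 2 * W n (r # js) + (\<Sum>l<r. W n (l # (r - 1 - l) # js)) + real r * \<gamma> n * W n ((r - 1) # js) +
        \<delta> n * (\<Sum>s<length js. real (js ! s) * W n (js[s := r + js ! s - 1])) = W n (Suc r # js)) sequentially"
    using W by eventually_elim (simp add: loop_system_def)
  from Lim_transform_eventually[OF lim this] show ?case .
qed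

text \<open>
  Cost of merging an entry \<open>j\<close> with the leading entry, relative to keeping them apart. Catalan
  numbers deviate from \<open>4 ^ m\<close> by a polynomial factor only, so the cost is polynomial in the degree and
  is absorbed by the tiny coefficient \<open>\<delta>\<close>.
\<close>

lemma catalan_insertion_ratio:
  assumes j: "j \<noteq> 0"
  shows "catalan (Suc (r + j - 1)) \<le> (real r + 3)\<^sup>2 * catalan (r + 2) * catalan (Suc j)"
proof (cases r)
  case 0
  have "catalan j \<le> catalan (Suc j)" by (rule catalan_le_Suc)
  also have "\<dots> \<le> 9 * catalan 2 * catalan (Suc j)"
    using catalan_pos[of "Suc j"] by (simp add: numeral_2_eq_2 catalan.simps(2)[of 0] catalan.simps(2)[of "Suc 0"])
  finally show ?thesis using 0 j by (simp add: numeral_2_eq_2)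
next
  case (Suc q)
  have "catalan (Suc (r + j - 1)) = catalan (q + Suc j)"
    using Suc j by simp
  also have "\<dots> \<le> 4 ^ q * catalan (Suc j)" by (rule catalan_add_le)
  also have "4 ^ q \<le> (4::real) ^ (r + 2)" using Suc by (intro power_increasing) auto
  also have "\<dots> \<le> (real r + 3)\<^sup>2 * catalan (r + 2)"
    using catalan_lower[of "r + 2"] by (simp add: add.commute)
  finally show ?thesis using catalan_pos[of "Suc j"] by (simp add: mult_right_mono)
qed

text \<open>
  This bound holds uniformly for degrees up to \<open>D\<close>, where \<open>D\<close> may grow with the dimension.
  The error terms are at most a small multiple of the main term, and the extra factor \<open>R\<close>
  gained with each unit of degree pays for them. All coefficients are nonnegative, so upper bounds for
  products of smaller degree can be inserted.
\<close>

lemma loop_system_upper_bound: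
  fixes D :: nat and R :: real
  assumes W: "loop_system \<gamma> \<delta> W"
    and \<gamma>: "\<gamma> \<ge> 0" and \<delta>: "\<delta> \<ge> 0" and R: "R \<ge> 1"
    and small: "1 + real D * \<gamma> + \<delta> * real D * (real D + 2)\<^sup>2 \<le> R"
    and js: "sum_list js \<le> D"
  shows "W js \<le> prod_list (map (\<lambda>j. R ^ j * catalan (Suc j)) js)"
  using js
proof (induction js rule: loop_induct)
  case Nil
  then show ?case using W by (simp add: loop_system_def)
next
  case (zero js)
  then show ?case using W by (simp add: loop_system_def)
next
  case (Suc r js)
  define f where "f j = R ^ j * catalan (Suc j)" for j
  let ?g = "\<lambda>js. prod_list (map f js)"
  let ?c = "catalan (r + 2)"
  have f_pos: "f j > 0" for j using R catalan_pos by (simp add: f_def)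
  have g_nonneg: "?g ks \<ge> 0" for ks using f_pos by (induction ks) (auto simp: less_imp_le)
  have cp: "?c > 0" by (rule catalan_pos)
  have rD: "r + sum_list js < D" using Suc.prems by simp
  have IH: "W ks \<le> ?g ks"
    if "sum_list ks \<le> r + sum_list js" "sum_list ks + length ks \<le> r + sum_list js + length js + 1" for ks
    using Suc.IH[OF that] that(1) rD unfolding f_def by linarith
  have main: "2 * W (r # js) + (\<Sum>l<r. W (l # (r - 1 - l) # js)) \<le> R ^ r * ?c * ?g js"
  proof -
    have "2 * W (r # js) + (\<Sum>l<r. W (l # (r - 1 - l) # js)) \<le>
          2 * ?g (r # js) + (\<Sum>l<r. ?g (l # (r - 1 - l) # js))"
      by (rule add_mono[OF mult_left_mono sum_mono]; (rule IH)?) auto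
    also have "\<dots> \<le> 2 * (R ^ r * catalan (Suc r) * ?g js) + (\<Sum>l<r. R ^ r * (catalan (Suc l) * catalan (r - l)) * ?g js)"
    proof (intro add_mono sum_mono)
      show "2 * ?g (r # js) \<le> 2 * (R ^ r * catalan (Suc r) * ?g js)"
        by (simp add: f_def)
      fix l assume l: "l \<in> {..<r}"
      have "?g (l # (r - 1 - l) # js) = R ^ (l + (r - 1 - l)) * (catalan (Suc l) * catalan (r - l)) * ?g js"
        using l by (simp only: list.map prod_list.Cons f_def power_add) (simp add: Suc_diff_Suc)
      also have "\<dots> \<le> R ^ r * (catalan (Suc l) * catalan (r - l)) * ?g js"
        using l R g_nonneg catalan_pos[of "Suc l"] catalan_pos[of "r - l"]
        by (intro mult_right_mono power_increasing) (auto intro!: mult_nonneg_nonneg)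
      finally show "?g (l # (r - 1 - l) # js) \<le> R ^ r * (catalan (Suc l) * catalan (r - l)) * ?g js" .
    qed
    also have "\<dots> = R ^ r * (2 * catalan (Suc r) + (\<Sum>l<r. catalan (Suc l) * catalan (r - l))) * ?g js"
      by (simp add: distrib_left distrib_right sum_distrib_left sum_distrib_right mult.assoc mult.left_commute)
    finally show ?thesis by (simp only: catalan_shifted_convolution)
  qed
  have diag: "real r * \<gamma> * W ((r - 1) # js) \<le> real D * \<gamma> * (R ^ r * ?c * ?g js)"
  proof -
    have "catalan (Suc (r - 1)) \<le> ?c"
    proof (cases r)
      case 0
      then show ?thesis using catalan_le_Suc[of "Suc 0"] by (simp add: numeral_2_eq_2)
    next
      case (Suc q)
      then show ?thesis using catalan_le_Suc[of "Suc q"] catalan_le_Suc[of "Suc (Suc q)"]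
        by simp
    qed
    then have "f (r - 1) \<le> R ^ r * ?c"
      unfolding f_def using R catalan_pos[of "Suc (r-1)"]
      by (intro mult_mono power_increasing) auto
    then have "W ((r - 1) # js) \<le> R ^ r * ?c * ?g js"
      using IH[of "(r - 1) # js"] g_nonneg[of js] mult_right_mono[of "f (r - 1)" "R ^ r * ?c" "?g js"] by simp
    then have "real r * \<gamma> * W ((r - 1) # js) \<le> real r * \<gamma> * (R ^ r * ?c * ?g js)"
      using \<gamma> by (intro mult_left_mono) auto
    also have "\<dots> \<le> real D * \<gamma> * (R ^ r * ?c * ?g js)"
      using \<gamma> rD R g_nonneg cp by (intro mult_right_mono mult_nonneg_nonneg) auto
    finally show ?thesis .
  qed
  have ins: "(\<Sum>s<length js. real (js ! s) * W (js[s := r + js ! s - 1]))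
      \<le> real D * (real D + 2)\<^sup>2 * (R ^ r * ?c * ?g js)"
  proof -
    have "real (js ! s) * W (js[s := r + js ! s - 1]) \<le> real (js ! s) * ((real D + 2)\<^sup>2 * (R ^ r * ?c * ?g js))"
      if s: "s < length js" for s
    proof (cases "js ! s = 0")
      case False
      let ?j = "js ! s"
      have "f (r + ?j - 1) \<le> R ^ (r + ?j) * ((real r + 3)\<^sup>2 * ?c * catalan (Suc ?j))"
        unfolding f_def using R catalan_pos[of "Suc (r + ?j - 1)"]
        by (intro mult_mono power_increasing catalan_insertion_ratio False) auto
      also have "\<dots> = (real r + 3)\<^sup>2 * (R ^ r * ?c) * f ?j"
        by (simp add: f_def power_add mult_ac)
      also have "\<dots> \<le> (real D + 2)\<^sup>2 * (R ^ r * ?c) * f ?j"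
        using rD R cp f_pos[of ?j] by (intro mult_right_mono power_mono mult_nonneg_nonneg) auto
      finally have *: "f (r + ?j - 1) / f ?j \<le> (real D + 2)\<^sup>2 * (R ^ r * ?c)"
        using f_pos[of ?j] by (simp add: divide_le_eq)
      have "W (js[s := r + ?j - 1]) \<le> ?g (js[s := r + ?j - 1])"
        by (intro IH loop_update_sum_le loop_update_measure_le s False)
      also have "\<dots> = f (r + ?j - 1) / f ?j * ?g js"
        using f_pos[of ?j] by (intro prod_list_map_update s) auto
      also have "\<dots> \<le> (real D + 2)\<^sup>2 * (R ^ r * ?c) * ?g js"
        by (intro mult_right_mono * g_nonneg)
      finally show ?thesis by (intro mult_left_mono) (auto simp: mult.assoc)
    qed simp
    then have "(\<Sum>s<length js. real (js ! s) * W (js[s := r + js ! s - 1]))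
        \<le> (\<Sum>s<length js. real (js ! s) * ((real D + 2)\<^sup>2 * (R ^ r * ?c * ?g js)))"
      by (intro sum_mono) auto
    also have "\<dots> = real (sum_list js) * ((real D + 2)\<^sup>2 * (R ^ r * ?c * ?g js))"
      by (simp add: sum_distrib_right[symmetric] sum_list_sum_nth atLeast0LessThan)
    also have "\<dots> \<le> real D * ((real D + 2)\<^sup>2 * (R ^ r * ?c * ?g js))"
      using rD R cp g_nonneg[of js] by (intro mult_right_mono mult_nonneg_nonneg) auto
    finally show ?thesis by (simp add: mult.assoc)
  qed
  have "W (Suc r # js) \<le> R ^ r * ?c * ?g js + real D * \<gamma> * (R ^ r * ?c * ?g js) +
      \<delta> * (real D * (real D + 2)\<^sup>2 * (R ^ r * ?c * ?g js))"
    using W main diag mult_left_mono[OF ins \<delta>] unfolding loop_system_def by (auto intro!: add_mono)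
  also have "\<dots> = (1 + real D * \<gamma> + \<delta> * real D * (real D + 2)\<^sup>2) * (R ^ r * ?c * ?g js)"
    by (simp add: algebra_simps)
  also have "\<dots> \<le> R * (R ^ r * ?c * ?g js)"
    using R cp g_nonneg[of js] by (intro mult_right_mono small mult_nonneg_nonneg) auto
  also have "\<dots> = ?g (Suc r # js)"
    by (simp add: f_def)
  finally show ?case unfolding f_def .
qed


section \<open>Functions of sub-Gaussian growth\<close>

definition sq_sum :: "nat \<Rightarrow> (nat \<Rightarrow> real) \<Rightarrow> real" where
  "sq_sum n x = (\<Sum>i\<in>{1..n}. (x i)\<^sup>2)"

lemma sq_sum_nonneg [simp]: "sq_sum n x \<ge> 0"
  by (simp add: sq_sum_def sum_nonneg)

lemma coord_le_sq_sum: "i \<in> {1..n} \<Longrightarrow> (x i)\<^sup>2 \<le> sq_sum n x"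
  unfolding sq_sum_def by (rule member_le_sum) auto

text \<open>
  Growth below every Gaussian is stable under sums, products and positive powers, and makes a
  measurable function integrable against every Gaussian weight. This spares explicit polynomial bounds.
\<close>

definition tame :: "nat \<Rightarrow> ((nat \<Rightarrow> real) \<Rightarrow> real) \<Rightarrow> bool" where
  "tame n h \<longleftrightarrow> (\<forall>c>0. \<exists>C. \<forall>x. \<bar>h x\<bar> \<le> C * exp (c * sq_sum n x))"

lemma tameE:
  assumes "tame n h" "c > 0"
  obtains C where "C \<ge> 0" "\<And>x. \<bar>h x\<bar> \<le> C * exp (c * sq_sum n x)"
proof -
  obtain C where C: "\<And>x. \<bar>h x\<bar> \<le> C * exp (c * sq_sum n x)"
    using assms unfolding tame_def by blast
  have "0 \<le> C * exp (c * sq_sum n undefined)" using C[of undefined] by linarith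
  then have "C \<ge> 0" by (simp add: zero_le_mult_iff)
  with C that show ?thesis by blast
qed

named_theorems tame_intros

lemma tame_const [tame_intros]: "tame n (\<lambda>x. k)"
  unfolding tame_def
proof (intro allI impI exI)
  fix c :: real and x :: "nat \<Rightarrow> real" assume "c > 0"
  then have "1 \<le> exp (c * sq_sum n x)" by simp
  from mult_left_mono[OF this, of "\<bar>k\<bar>"] show "\<bar>k\<bar> \<le> \<bar>k\<bar> * exp (c * sq_sum n x)" by simp
qed

lemma tame_bound:
  assumes "tame n h" "\<And>x. \<bar>g x\<bar> \<le> K * \<bar>h x\<bar>"
  shows "tame n g"
  unfolding tame_def
proof (intro allI impI)
  fix c :: real assume "c > 0"
  then obtain C where C: "C \<ge> 0" "\<And>x. \<bar>h x\<bar> \<le> C * exp (c * sq_sum n x)" using tameE[OF assms(1)] by metis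
  have "\<bar>g x\<bar> \<le> \<bar>K\<bar> * C * exp (c * sq_sum n x)" for x
  proof -
    have "\<bar>g x\<bar> \<le> \<bar>K\<bar> * \<bar>h x\<bar>" using assms(2)[of x] mult_right_mono[OF abs_ge_self[of K], of "\<bar>h x\<bar>"] by simp
    also have "\<dots> \<le> \<bar>K\<bar> * (C * exp (c * sq_sum n x))" by (intro mult_left_mono C) auto
    finally show ?thesis by (simp add: mult.assoc)
  qed
  then show "\<exists>C. \<forall>x. \<bar>g x\<bar> \<le> C * exp (c * sq_sum n x)" by blast
qed

lemma tame_coord [tame_intros]:
  assumes "i \<in> {1..n}"
  shows "tame n (\<lambda>x. x i)"
  unfolding tame_def
proof (intro allI impI exI)
  fix c :: real and x :: "nat \<Rightarrow> real" assume c: "c > 0"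
  let ?e = "exp (c * sq_sum n x)"
  have s: "(x i)\<^sup>2 \<le> sq_sum n x" using assms by (rule coord_le_sq_sum)
  have "c * (x i)\<^sup>2 \<le> c * sq_sum n x" using s c by simp
  also have "\<dots> \<le> ?e" using exp_ge_add_one_self[of "c * sq_sum n x"] by linarith
  finally have "(x i)\<^sup>2 \<le> 1 / c * ?e" using c by (simp add: field_simps)
  moreover have "1 \<le> ?e" using c by simp
  moreover have "\<bar>x i\<bar> \<le> 1 + (x i)\<^sup>2"
    using sum_squares_ge_zero[of "\<bar>x i\<bar> - 1" 0] zero_le_power2[of "x i"] by (simp add: power2_eq_square algebra_simps)
  ultimately show "\<bar>x i\<bar> \<le> (1 + 1 / c) * ?e" unfolding distrib_right by linarith
qed

lemma tame_add [tame_intros]: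
  assumes "tame n g" "tame n h"
  shows "tame n (\<lambda>x. g x + h x)"
  unfolding tame_def
proof (intro allI impI)
  fix c :: real assume "c > 0"
  then obtain C D where "\<And>x. \<bar>g x\<bar> \<le> C * exp (c * sq_sum n x)" "\<And>x. \<bar>h x\<bar> \<le> D * exp (c * sq_sum n x)"
    using tameE[OF assms(1)] tameE[OF assms(2)] by metis
  then have "\<bar>g x + h x\<bar> \<le> (C + D) * exp (c * sq_sum n x)" for x
    unfolding distrib_right by (meson abs_triangle_ineq add_mono order_trans)
  then show "\<exists>C. \<forall>x. \<bar>g x + h x\<bar> \<le> C * exp (c * sq_sum n x)" by blast
qed

lemma tame_mult [tame_intros]:
  assumes "tame n g" "tame n h"
  shows "tame n (\<lambda>x. g x * h x)"
  unfolding tame_def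
proof (intro allI impI)
  fix c :: real assume "c > 0"
  then have c2: "c / 2 > 0" by simp
  obtain C D where C: "C \<ge> 0" "\<And>x. \<bar>g x\<bar> \<le> C * exp (c / 2 * sq_sum n x)"
    and D: "D \<ge> 0" "\<And>x. \<bar>h x\<bar> \<le> D * exp (c / 2 * sq_sum n x)"
    using tameE[OF assms(1) c2] tameE[OF assms(2) c2] by metis
  have "\<bar>g x * h x\<bar> \<le> C * D * exp (c * sq_sum n x)" for x
  proof -
    have "\<bar>g x * h x\<bar> \<le> (C * exp (c / 2 * sq_sum n x)) * (D * exp (c / 2 * sq_sum n x))"
      unfolding abs_mult by (intro mult_mono C D mult_nonneg_nonneg) auto
    also have "\<dots> = C * D * (exp (c / 2 * sq_sum n x) * exp (c / 2 * sq_sum n x))" by simp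
    also have "exp (c / 2 * sq_sum n x) * exp (c / 2 * sq_sum n x) = exp (c * sq_sum n x)"
      by (simp flip: exp_add)
    finally show ?thesis .
  qed
  then show "\<exists>C. \<forall>x. \<bar>g x * h x\<bar> \<le> C * exp (c * sq_sum n x)" by blast
qed

lemma tame_abs [tame_intros]: "tame n h \<Longrightarrow> tame n (\<lambda>x. \<bar>h x\<bar>)"
  by (rule tame_bound[where K = 1]) auto

lemma tame_diff [tame_intros]: "tame n g \<Longrightarrow> tame n h \<Longrightarrow> tame n (\<lambda>x. g x - h x)"
  using tame_add[of n g "\<lambda>x. (-1) * h x"] tame_mult[of n "\<lambda>_. -1" h] tame_const[of n "-1"] by simp

lemma tame_divide_const [tame_intros]: "tame n h \<Longrightarrow> tame n (\<lambda>x. h x / k)"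
  unfolding divide_inverse by (intro tame_intros)

lemma tame_power [tame_intros]: "tame n h \<Longrightarrow> tame n (\<lambda>x. h x ^ k)"
  by (induction k) (auto intro: tame_intros)

lemma tame_sum [tame_intros]: "(\<And>i. i \<in> I \<Longrightarrow> tame n (h i)) \<Longrightarrow> tame n (\<lambda>x. \<Sum>i\<in>I. h i x)"
  by (induction I rule: infinite_finite_induct) (auto intro: tame_intros)

lemma tame_prod [tame_intros]: "(\<And>i. i \<in> I \<Longrightarrow> tame n (h i)) \<Longrightarrow> tame n (\<lambda>x. \<Prod>i\<in>I. h i x)"
  by (induction I rule: infinite_finite_induct) (auto intro: tame_intros)

lemma tame_powr:
  assumes "tame n h" "p \<ge> 0" "\<And>x. h x \<ge> 0"
  shows "tame n (\<lambda>x. h x powr p)"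
  unfolding tame_def
proof (intro allI impI)
  fix c :: real assume c: "c > 0"
  then have "c / (p + 1) > 0" using assms by simp
  then obtain C where C: "C \<ge> 0" "\<And>x. \<bar>h x\<bar> \<le> C * exp (c / (p + 1) * sq_sum n x)"
    using tameE[OF assms(1)] by metis
  have "\<bar>h x powr p\<bar> \<le> C powr p * exp (c * sq_sum n x)" for x
  proof -
    have "h x powr p \<le> (C * exp (c / (p + 1) * sq_sum n x)) powr p"
      using C(2)[of x] assms by (intro powr_mono2) auto
    also have "\<dots> = C powr p * exp (c * (p / (p + 1)) * sq_sum n x)"
      using C by (simp add: powr_mult exp_powr_real mult_ac)
    also have "\<dots> \<le> C powr p * exp (c * sq_sum n x)"
    proof -
      have "c * (p / (p + 1)) \<le> c" using assms(2) c by (simp add: field_simps)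
      from mult_right_mono[OF this sq_sum_nonneg] show ?thesis by (intro mult_left_mono) auto
    qed
    finally show ?thesis by simp
  qed
  then show "\<exists>C. \<forall>x. \<bar>h x powr p\<bar> \<le> C * exp (c * sq_sum n x)" by blast
qed

lemma measurable_coord [measurable (raw)]:
  "i \<in> {1..n} \<Longrightarrow> (\<lambda>x. x i) \<in> borel_measurable (euclid n)"
  using measurable_component_singleton[of i "{1..n}" "\<lambda>_. lborel :: real measure"] by simp

lemma measurable_sq_sum [measurable]: "sq_sum n \<in> borel_measurable (euclid n)"
  unfolding sq_sum_def by (intro borel_measurable_sum borel_measurable_power measurable_coord)

lemma integrable_exp_neg_square:
  assumes "(c::real) > 0"
  shows "integrable lborel (\<lambda>t. exp (- c * t\<^sup>2))"
proof -
  let ?\<sigma> = "sqrt (1 / (2 * c))"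
  have "integrable lborel (\<lambda>t. sqrt (2 * pi * ?\<sigma>\<^sup>2) * normal_density 0 ?\<sigma> t)"
    using assms by (intro integrable_mult_right integrable_normal_density) auto
  also have "(\<lambda>t. sqrt (2 * pi * ?\<sigma>\<^sup>2) * normal_density 0 ?\<sigma> t) = (\<lambda>t. exp (- c * t\<^sup>2))"
    using assms by (auto simp: normal_density_def fun_eq_iff)
  finally show ?thesis .
qed

lemma integrable_gaussian:
  assumes "c > 0"
  shows "integrable (euclid n) (\<lambda>x. exp (- c * sq_sum n x))"
proof -
  interpret product_sigma_finite "\<lambda>_::nat. lborel :: real measure" ..
  have "integrable (euclid n) (\<lambda>x. \<Prod>i\<in>{1..n}. exp (- c * (x i)\<^sup>2))"
    by (intro product_integrable_prod integrable_exp_neg_square assms) auto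
  then show ?thesis by (simp add: sq_sum_def exp_sum sum_distrib_left flip: sum_negf)
qed

lemma tame_times_gaussian_bound:
  assumes "tame n h" "c > 0"
  obtains C where "C \<ge> 0" "\<And>x. \<bar>h x * exp (- c * sq_sum n x)\<bar> \<le> C * exp (- (c / 2) * sq_sum n x)"
proof -
  have "c / 2 > 0" using assms by simp
  then obtain C where C: "C \<ge> 0" "\<And>x. \<bar>h x\<bar> \<le> C * exp (c / 2 * sq_sum n x)"
    using tameE[OF assms(1)] by metis
  have "\<bar>h x * exp (- c * sq_sum n x)\<bar> \<le> C * exp (- (c / 2) * sq_sum n x)" for x
  proof -
    have "\<bar>h x * exp (- c * sq_sum n x)\<bar> \<le> C * exp (c / 2 * sq_sum n x) * exp (- c * sq_sum n x)"
      unfolding abs_mult using C(2)[of x] by (simp add: mult_right_mono)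
    also have "\<dots> = C * exp (- (c / 2) * sq_sum n x)" by (simp flip: exp_add)
    finally show ?thesis .
  qed
  with C that show ?thesis by blast
qed

lemma tame_integrable:
  assumes "tame n h" "c > 0" and [measurable]: "h \<in> borel_measurable (euclid n)"
  shows "integrable (euclid n) (\<lambda>x. h x * exp (- c * sq_sum n x))"
proof -
  obtain C where C: "C \<ge> 0" "\<And>x. \<bar>h x * exp (- c * sq_sum n x)\<bar> \<le> C * exp (- (c / 2) * sq_sum n x)"
    using tame_times_gaussian_bound[OF assms(1,2)] by metis
  show ?thesis
  proof (rule Bochner_Integration.integrable_bound)
    show "integrable (euclid n) (\<lambda>x. C * exp (- (c / 2) * sq_sum n x))"
      using assms by (intro integrable_mult_right integrable_gaussian) auto
    show "(\<lambda>x. h x * exp (- c * sq_sum n x)) \<in> borel_measurable (euclid n)" by measurable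
    show "AE x in euclid n. norm (h x * exp (- c * sq_sum n x)) \<le> norm (C * exp (- (c / 2) * sq_sum n x))"
      using C by (auto simp: abs_mult)
  qed
qed

section \<open>Integration by parts\<close>

text \<open>
  The fundamental theorem for the gauge integral is applied on \<open>[-m, m]\<close>, and integrability lets \<open>m\<close>
  tend to infinity.
\<close>

lemma integral_derivative_zero:
  fixes g g' :: "real \<Rightarrow> real"
  assumes deriv: "\<And>t. (g has_real_derivative g' t) (at t)"
    and int: "integrable lborel g'"
    and top: "(g \<longlongrightarrow> 0) at_top" and bot: "(g \<longlongrightarrow> 0) at_bot"
  shows "(\<integral>t. g' t \<partial>lborel) = 0"
proof -
  have meas [measurable]: "g' \<in> borel_measurable borel" using borel_measurable_integrable[OF int] by simp
  have "(\<lambda>m. \<integral>t. indicator {- real m..real m} t *\<^sub>R g' t \<partial>lborel) \<longlonglongrightarrow> (\<integral>t. g' t \<partial>lborel)"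
  proof (rule integral_dominated_convergence[where w = "\<lambda>t. \<bar>g' t\<bar>"])
    show "AE t in lborel. (\<lambda>m. indicator {- real m..real m} t *\<^sub>R g' t) \<longlonglongrightarrow> g' t"
    proof (intro AE_I2 tendsto_eventually)
      fix t :: real
      show "eventually (\<lambda>m. indicator {- real m..real m} t *\<^sub>R g' t = g' t) sequentially"
        using eventually_ge_at_top[of "nat \<lceil>\<bar>t\<bar>\<rceil>"]
        by eventually_elim (auto simp: indicator_def)
    qed
  qed (use int in \<open>auto simp: indicator_def\<close>)
  moreover have "(\<integral>t. indicator {- real m..real m} t *\<^sub>R g' t \<partial>lborel) = g (real m) - g (- real m)" for m
  proof -
    have "set_integrable lborel {- real m..real m} g'"
      unfolding set_integrable_def by (rule integrable_mult_indicator) (use int in auto)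
    then have "(\<integral>t. indicator {- real m..real m} t *\<^sub>R g' t \<partial>lborel) = integral {- real m..real m} g'"
      using set_borel_integral_eq_integral(2) unfolding set_lebesgue_integral_def by blast
    also have "\<dots> = g (real m) - g (- real m)"
      by (intro integral_unique fundamental_theorem_of_calculus)
         (auto intro: has_field_derivative_at_within deriv simp flip: has_real_derivative_iff_has_vector_derivative)
    finally show ?thesis .
  qed
  moreover have "(\<lambda>m. g (real m) - g (- real m)) \<longlonglongrightarrow> 0 - 0"
    by (intro tendsto_diff filterlim_compose[OF top] filterlim_compose[OF bot] filterlim_real_sequentially
          filterlim_compose[OF filterlim_uminus_at_bot_at_top])
  ultimately show ?thesis using LIMSEQ_unique by auto
qed

text \<open>
  The derivative is taken at the current value of the coordinate \<open>i\<close>. In this form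
  the rules of calculus relate plain functions of \<open>x\<close>, without substitutions.
\<close>

definition has_partial :: "nat \<Rightarrow> ((nat \<Rightarrow> real) \<Rightarrow> real) \<Rightarrow> ((nat \<Rightarrow> real) \<Rightarrow> real) \<Rightarrow> bool" where
  "has_partial i g g' \<longleftrightarrow> (\<forall>x. ((\<lambda>t. g (x(i := t))) has_real_derivative g' x) (at (x i)))"

lemma has_partialD:
  assumes "has_partial i g g'"
  shows "((\<lambda>t. g (x(i := t))) has_real_derivative g' (x(i := t))) (at t)"
  using assms[unfolded has_partial_def, rule_format, of "x(i := t)"] by simp

lemma has_partial_eq:
  "has_partial i g g' \<Longrightarrow> (\<And>x. g' x = g'' x) \<Longrightarrow> has_partial i g g''"
  by (simp add: has_partial_def)

lemma has_partial_const: "has_partial i (\<lambda>x. k) (\<lambda>x. 0)"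
  by (simp add: has_partial_def)

lemma has_partial_coord: "has_partial i (\<lambda>x. x a) (\<lambda>x. if a = i then 1 else 0)"
  by (auto simp: has_partial_def)

lemma has_partial_add:
  "has_partial i g g' \<Longrightarrow> has_partial i h h' \<Longrightarrow> has_partial i (\<lambda>x. g x + h x) (\<lambda>x. g' x + h' x)"
  unfolding has_partial_def by (auto intro!: derivative_intros)

lemma has_partial_diff:
  "has_partial i g g' \<Longrightarrow> has_partial i h h' \<Longrightarrow> has_partial i (\<lambda>x. g x - h x) (\<lambda>x. g' x - h' x)"
  unfolding has_partial_def by (auto intro!: derivative_intros)

lemma has_partial_mult:
  "has_partial i g g' \<Longrightarrow> has_partial i h h' \<Longrightarrow> has_partial i (\<lambda>x. g x * h x) (\<lambda>x. g' x * h x + g x * h' x)"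
  unfolding has_partial_def
  by (auto intro!: derivative_eq_intros simp: algebra_simps)

lemma has_partial_cmult:
  "has_partial i h h' \<Longrightarrow> has_partial i (\<lambda>x. k * h x) (\<lambda>x. k * h' x)"
  by (rule has_partial_eq[OF has_partial_mult[OF has_partial_const]]) auto

lemma has_partial_power:
  "has_partial i g g' \<Longrightarrow> has_partial i (\<lambda>x. g x ^ k) (\<lambda>x. real k * g x ^ (k - 1) * g' x)"
  unfolding has_partial_def by (auto intro!: derivative_eq_intros)

lemma has_partial_exp:
  "has_partial i g g' \<Longrightarrow> has_partial i (\<lambda>x. exp (g x)) (\<lambda>x. exp (g x) * g' x)"
  unfolding has_partial_def by (auto intro!: derivative_eq_intros)

lemma has_partial_ln:
  "has_partial i g g' \<Longrightarrow> (\<And>x. g x > 0) \<Longrightarrow> has_partial i (\<lambda>x. ln (g x)) (\<lambda>x. g' x / g x)"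
  unfolding has_partial_def by (auto intro!: derivative_eq_intros)

lemma has_partial_sum:
  "(\<And>a. a \<in> I \<Longrightarrow> has_partial i (g a) (g' a)) \<Longrightarrow> has_partial i (\<lambda>x. \<Sum>a\<in>I. g a x) (\<lambda>x. \<Sum>a\<in>I. g' a x)"
  unfolding has_partial_def by (auto intro!: DERIV_sum)

lemma has_partial_sq_sum:
  assumes "i \<in> {1..n}"
  shows "has_partial i (sq_sum n) (\<lambda>x. 2 * x i)"
proof (rule has_partial_eq)
  show "has_partial i (sq_sum n) (\<lambda>x. \<Sum>a\<in>{1..n}. real 2 * x a ^ (2 - 1) * (if a = i then 1 else 0))"
    unfolding sq_sum_def by (intro has_partial_sum has_partial_power has_partial_coord)
  show "(\<Sum>a\<in>{1..n}. real 2 * x a ^ (2 - 1) * (if a = i then 1 else 0)) = 2 * x i" for x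
    using assms by (simp add: if_distrib[of "\<lambda>z. _ * z"] sum.delta cong: if_cong)
qed

lemma exp_neg_square_tendsto:
  assumes "(c::real) > 0"
  shows "((\<lambda>t. C * exp (- c * t\<^sup>2)) \<longlongrightarrow> 0) at_top" "((\<lambda>t. C * exp (- c * t\<^sup>2)) \<longlongrightarrow> 0) at_bot"
proof -
  have *: "((\<lambda>t. C * exp (- c * t)) \<longlongrightarrow> C * 0) at_top"
    using assms by (intro tendsto_mult tendsto_const filterlim_compose[OF exp_at_bot]
      filterlim_tendsto_neg_mult_at_bot[OF tendsto_const]) (auto simp: filterlim_ident)
  have top: "filterlim (\<lambda>t::real. t\<^sup>2) at_top at_top"
    by (rule filterlim_pow_at_top) (auto simp: filterlim_ident)
  then have bot: "filterlim (\<lambda>t::real. t\<^sup>2) at_top at_bot"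
    by (simp add: filterlim_at_bot_mirror)
  show "((\<lambda>t. C * exp (- c * t\<^sup>2)) \<longlongrightarrow> 0) at_top" "((\<lambda>t. C * exp (- c * t\<^sup>2)) \<longlongrightarrow> 0) at_bot"
    using filterlim_compose[OF * top] filterlim_compose[OF * bot] by auto
qed

text \<open>
  Fubini, with the coordinate \<open>i\<close> integrated first: for fixed other coordinates the function is
  bounded by a one-dimensional Gaussian, so the integral of its derivative vanishes.
\<close>

lemma integral_partial_zero:
  assumes i: "i \<in> {1..n}" and c: "c > 0"
    and h: "tame n h" and h': "tame n h'" "h' \<in> borel_measurable (euclid n)"
    and part: "has_partial i (\<lambda>x. h x * exp (- c * sq_sum n x)) (\<lambda>x. h' x * exp (- c * sq_sum n x))"
  shows "(\<integral>x. h' x * exp (- c * sq_sum n x) \<partial>euclid n) = 0"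
proof -
  interpret product_sigma_finite "\<lambda>_::nat. lborel :: real measure" ..
  let ?I = "{1..n} - {i}"
  let ?G = "\<lambda>x. h x * exp (- c * sq_sum n x)" and ?G' = "\<lambda>x. h' x * exp (- c * sq_sum n x)"
  have ins: "insert i ?I = {1..n}" using i by auto
  have sq: "t\<^sup>2 \<le> sq_sum n (x(i := t))" for x t
    using coord_le_sq_sum[OF i, of "x(i := t)"] by simp
  have gauss_bound: "\<exists>C\<ge>0. \<forall>x t. \<bar>k (x(i := t)) * exp (- c * sq_sum n (x(i := t)))\<bar> \<le> C * exp (- (c / 2) * t\<^sup>2)"
    if k: "tame n k" for k
  proof -
    obtain C where C: "C \<ge> 0" "\<And>x. \<bar>k x * exp (- c * sq_sum n x)\<bar> \<le> C * exp (- (c / 2) * sq_sum n x)"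
      using tame_times_gaussian_bound[OF k c] by metis
    have "\<bar>k (x(i := t)) * exp (- c * sq_sum n (x(i := t)))\<bar> \<le> C * exp (- (c / 2) * t\<^sup>2)" for x t
      by (rule order_trans[OF C(2)], intro mult_left_mono C(1)) (use sq[of t x] c in simp)
    with C(1) show ?thesis by blast
  qed
  obtain C where C: "\<And>x t. \<bar>?G (x(i := t))\<bar> \<le> C * exp (- (c / 2) * t\<^sup>2)"
    using gauss_bound[OF h] by blast
  obtain C' where C': "C' \<ge> 0" "\<And>x t. \<bar>?G' (x(i := t))\<bar> \<le> C' * exp (- (c / 2) * t\<^sup>2)"
    using gauss_bound[OF h'(1)] by blast
  have int: "integrable (Pi\<^sub>M (insert i ?I) (\<lambda>_. lborel)) ?G'"
    unfolding ins by (rule tame_integrable[OF h'(1) c h'(2)])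
  have "(\<integral>x. ?G' x \<partial>euclid n) = (\<integral>x. (\<integral>t. ?G' (x(i := t)) \<partial>lborel) \<partial>Pi\<^sub>M ?I (\<lambda>_. lborel))"
    using product_integral_insert[OF _ _ int] unfolding ins by auto
  also have "\<dots> = (\<integral>x. 0 \<partial>Pi\<^sub>M ?I (\<lambda>_. lborel :: real measure))"
  proof (rule Bochner_Integration.integral_cong[OF refl])
    fix x :: "nat \<Rightarrow> real" assume x: "x \<in> space (Pi\<^sub>M ?I (\<lambda>_. lborel))"
    show "(\<integral>t. ?G' (x(i := t)) \<partial>lborel) = 0"
    proof (rule integral_derivative_zero)
      show "((\<lambda>t. ?G (x(i := t))) has_real_derivative ?G' (x(i := t))) (at t)" for t
        by (rule has_partialD[OF part])
      show "integrable lborel (\<lambda>t. ?G' (x(i := t)))"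
      proof (rule Bochner_Integration.integrable_bound)
        show "integrable lborel (\<lambda>t. C' * exp (- (c / 2) * t\<^sup>2))"
          using c by (intro integrable_mult_right integrable_exp_neg_square) auto
        show "(\<lambda>t. ?G' (x(i := t))) \<in> borel_measurable lborel"
          using measurable_comp[OF measurable_component_update[OF x] borel_measurable_integrable[OF int]]
          by (simp add: comp_def)
        show "AE t in lborel. norm (?G' (x(i := t))) \<le> norm (C' * exp (- (c / 2) * t\<^sup>2))"
          using C' by (auto simp: abs_mult)
      qed
      have "c / 2 > 0" using c by simp
      note lim = exp_neg_square_tendsto[OF this, of C]
      show "((\<lambda>t. ?G (x(i := t))) \<longlongrightarrow> 0) at_top" "((\<lambda>t. ?G (x(i := t))) \<longlongrightarrow> 0) at_bot"
        using C by (auto intro!: Lim_null_comparison[OF _ lim(1)] Lim_null_comparison[OF _ lim(2)] always_eventually)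
    qed
  qed
  finally show ?thesis by simp
qed


section \<open>Power means and the repulsion\<close>

text \<open>
  The eigenvalues are shifted by \<open>2\<close>, which moves the limiting support \<open>[-2, 2]\<close> to
  \<open>[0, 4]\<close>. Moments of every order are then positive in the limit, and the upper edge of the support
  alone governs their growth.
\<close>

definition power_mean :: "nat \<Rightarrow> nat \<Rightarrow> (nat \<Rightarrow> real) \<Rightarrow> real" where
  "power_mean n j x = (\<Sum>i\<in>{1..n}. (x i + 2) ^ j) / real n"

definition mean_prod :: "nat \<Rightarrow> nat list \<Rightarrow> (nat \<Rightarrow> real) \<Rightarrow> real" where
  "mean_prod n js x = prod_list (map (\<lambda>j. power_mean n j x) js)"

lemma mean_prod_simps [simp]:
  "mean_prod n [] x = 1"
  "mean_prod n (j # js) x = power_mean n j x * mean_prod n js x"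
  by (simp_all add: mean_prod_def)

lemma mean_prod_fun:
  "mean_prod n [] = (\<lambda>x. 1)"
  "mean_prod n (j # js) = (\<lambda>x. power_mean n j x * mean_prod n js x)"
  by (simp_all add: fun_eq_iff)

fun mean_prod_partial :: "nat \<Rightarrow> nat \<Rightarrow> nat list \<Rightarrow> (nat \<Rightarrow> real) \<Rightarrow> real" where
  "mean_prod_partial n i [] x = 0"
| "mean_prod_partial n i (j # js) x =
     real j * (x i + 2) ^ (j - 1) / real n * mean_prod n js x + power_mean n j x * mean_prod_partial n i js x"

lemma power_mean_0: "n \<ge> 1 \<Longrightarrow> power_mean n 0 x = 1"
  by (simp add: power_mean_def)

lemma tame_power_mean [tame_intros]: "tame n (power_mean n j)"
  unfolding power_mean_def by (intro tame_intros)

lemma measurable_power_mean [measurable]: "power_mean n j \<in> borel_measurable (euclid n)"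
  unfolding power_mean_def by (intro borel_measurable_divide borel_measurable_sum borel_measurable_power
    borel_measurable_add measurable_coord) auto

lemma tame_mean_prod [tame_intros]: "tame n (mean_prod n js)"
  by (induction js) (auto simp: mean_prod_fun intro!: tame_intros)

lemma measurable_mean_prod [measurable]: "mean_prod n js \<in> borel_measurable (euclid n)"
proof (induction js)
  case Nil
  show ?case unfolding mean_prod_fun by (rule borel_measurable_const)
next
  case (Cons j js)
  show ?case unfolding mean_prod_fun by (intro borel_measurable_times measurable_power_mean Cons.IH)
qed

lemma mean_prod_partial_fun:
  "mean_prod_partial n i [] = (\<lambda>x. 0)"
  "mean_prod_partial n i (j # js) = (\<lambda>x. real j * (x i + 2) ^ (j - 1) / real n * mean_prod n js x +
     power_mean n j x * mean_prod_partial n i js x)"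
  by (simp_all add: fun_eq_iff)

lemma tame_mean_prod_partial [tame_intros]:
  assumes "i \<in> {1..n}"
  shows "tame n (mean_prod_partial n i js)"
proof (induction js)
  case Nil
  show ?case unfolding mean_prod_partial_fun by (rule tame_const)
next
  case (Cons j js)
  show ?case unfolding mean_prod_partial_fun by (intro tame_intros Cons.IH assms)
qed

lemma measurable_mean_prod_partial [measurable]:
  assumes "i \<in> {1..n}"
  shows "mean_prod_partial n i js \<in> borel_measurable (euclid n)"
proof (induction js)
  case Nil
  show ?case unfolding mean_prod_partial_fun by (rule borel_measurable_const)
next
  case (Cons j js)
  show ?case unfolding mean_prod_partial_fun
    by (intro borel_measurable_add borel_measurable_times borel_measurable_divide borel_measurable_power
     borel_measurable_const measurable_coord measurable_power_mean measurable_mean_prod Cons.IH assms)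
qed

lemma has_partial_power_mean:
  assumes "i \<in> {1..n}"
  shows "has_partial i (power_mean n j) (\<lambda>x. real j * (x i + 2) ^ (j - 1) / real n)"
proof -
  have "has_partial i (\<lambda>x. (1 / real n) * (\<Sum>a\<in>{1..n}. (x a + 2) ^ j))
      (\<lambda>x. (1 / real n) * (\<Sum>a\<in>{1..n}. real j * (x a + 2) ^ (j - 1) * ((if a = i then 1 else 0) + 0)))"
    by (intro has_partial_cmult has_partial_sum has_partial_power has_partial_add has_partial_coord has_partial_const)
  then have "has_partial i (power_mean n j)
      (\<lambda>x. (1 / real n) * (\<Sum>a\<in>{1..n}. real j * (x a + 2) ^ (j - 1) * ((if a = i then 1 else 0) + 0)))"
    by (simp add: power_mean_def[abs_def])
  then show ?thesis
    by (rule has_partial_eq) (use assms in \<open>simp add: if_distrib[of "\<lambda>z. _ * z"] sum.delta cong: if_cong\<close>)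
qed

lemma has_partial_mean_prod:
  assumes "i \<in> {1..n}"
  shows "has_partial i (mean_prod n js) (mean_prod_partial n i js)"
proof (induction js)
  case Nil
  show ?case unfolding mean_prod_fun mean_prod_partial_fun by (rule has_partial_const)
next
  case (Cons j js)
  from has_partial_mult[OF has_partial_power_mean[OF assms] Cons.IH]
  show ?case unfolding mean_prod_fun mean_prod_partial_fun .
qed

text \<open>
  The action of the vector field \<open>\<Sum>i. y\<^sub>i ^ r \<partial>\<^sub>i\<close>, where \<open>y\<^sub>i = x\<^sub>i + 2\<close>, on a product of power means: it
  raises one factor at a time.
\<close>

lemma sum_mean_prod_partial:
  "(\<Sum>i\<in>{1..n}. (x i + 2) ^ r * mean_prod_partial n i js x) =
   (\<Sum>s<length js. real (js ! s) * mean_prod n (js[s := r + js ! s - 1]) x)"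
proof (induction js)
  case (Cons j js)
  have head: "(\<Sum>i\<in>{1..n}. (x i + 2) ^ r * (real j * (x i + 2) ^ (j - 1) / real n)) = real j * power_mean n (r + j - 1) x"
  proof (cases j)
    case (Suc k)
    then show ?thesis
      by (simp add: power_mean_def sum_distrib_left sum_divide_distrib power_add mult_ac)
  qed simp
  have "(\<Sum>i\<in>{1..n}. (x i + 2) ^ r * mean_prod_partial n i (j # js) x) =
     (\<Sum>i\<in>{1..n}. (x i + 2) ^ r * (real j * (x i + 2) ^ (j - 1) / real n)) * mean_prod n js x +
     power_mean n j x * (\<Sum>i\<in>{1..n}. (x i + 2) ^ r * mean_prod_partial n i js x)"
    by (simp add: distrib_left sum.distrib sum_distrib_left sum_distrib_right mult_ac)
  then show ?case
    unfolding head Cons.IH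
    by (simp add: sum.lessThan_Suc_shift sum_distrib_left mult_ac del: sum.lessThan_Suc)
qed simp

text \<open>
  For \<open>\<eta> = 0\<close> this is the interaction factor of the ensemble; each unordered pair occurs
  twice, which is why the exponent of the squared distance is \<open>b / 4\<close>. For \<open>b < 1\<close> the derivative of
  \<open>\<bar>x\<^sub>i - x\<^sub>j\<bar> powr b\<close> is unbounded at collisions, so the distance is regularised by
  \<open>\<eta> \<noteq> 0\<close>, which makes the factor smooth.
\<close>

definition repulsion :: "nat \<Rightarrow> real \<Rightarrow> real \<Rightarrow> (nat \<Rightarrow> real) \<Rightarrow> real" where
  "repulsion n b \<eta> x = (\<Prod>i\<in>{1..n}. \<Prod>j\<in>{1..n} - {i}. ((x i - x j)\<^sup>2 + \<eta>\<^sup>2) powr (b / 4))"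

text \<open>
  The logarithmic derivative of the repulsion in the coordinate \<open>i\<close>.
\<close>

definition repulsion_force :: "nat \<Rightarrow> real \<Rightarrow> real \<Rightarrow> nat \<Rightarrow> (nat \<Rightarrow> real) \<Rightarrow> real" where
  "repulsion_force n b \<eta> i x = (\<Sum>a\<in>{1..n}. \<Sum>c\<in>{1..n} - {a}.
     b / 2 * (x a - x c) * ((if a = i then 1 else 0) - (if c = i then 1 else 0)) / ((x a - x c)\<^sup>2 + \<eta>\<^sup>2))"

lemma gbe_weight_eq:
  "gbe_weight n a b x = repulsion n b 0 x * exp (- (a / 2) * sq_sum n x)"
proof -
  let ?p = "\<lambda>(i, j). \<bar>x i - x j\<bar> powr b" and ?q = "\<lambda>(i, j). \<bar>x i - x j\<bar> powr (b / 2)"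
  let ?L = "{(i, j). 1 \<le> i \<and> i < j \<and> j \<le> n}" and ?U = "{(i, j). 1 \<le> j \<and> j < i \<and> i \<le> n}"
  have fin: "finite ?L" "finite ?U"
    by (rule finite_subset[of _ "{1..n} \<times> {1..n}"]; auto)+
  have "repulsion n b 0 x = (\<Prod>i\<in>{1..n}. \<Prod>j\<in>{1..n} - {i}. ?q (i, j))"
    unfolding repulsion_def
  proof (intro prod.cong refl)
    fix i j
    show "((x i - x j)\<^sup>2 + 0\<^sup>2) powr (b / 4) = ?q (i, j)"
    proof (cases "x i = x j")
      case False
      then have "((x i - x j)\<^sup>2 + 0\<^sup>2) powr (b / 4) = (\<bar>x i - x j\<bar> powr 2) powr (b / 4)"
        by simp
      then show ?thesis by (simp only: powr_powr) simp
    qed simp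
  qed
  also have "\<dots> = prod ?q (SIGMA i:{1..n}. {1..n} - {i})"
    by (subst prod.Sigma) auto
  also have "(SIGMA i:{1..n}. {1..n} - {i}) = ?L \<union> ?U" by auto
  also have "prod ?q (?L \<union> ?U) = prod ?q ?L * prod ?q ?U"
    by (intro prod.union_disjoint fin) auto
  also have "prod ?q ?U = prod ?q ?L"
    by (rule prod.reindex_bij_witness[of _ prod.swap prod.swap]) (auto simp: abs_minus_commute)
  also have "prod ?q ?L * prod ?q ?L = prod ?p ?L"
    unfolding prod.distrib[symmetric]
    by (intro prod.cong refl) (auto simp flip: powr_add)
  finally show ?thesis by (simp add: gbe_weight_def sq_sum_def)
qed

lemma repulsion_nonneg [simp]: "repulsion n b \<eta> x \<ge> 0"
  unfolding repulsion_def by (intro prod_nonneg) auto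

lemma tame_repulsion [tame_intros]: "b > 0 \<Longrightarrow> tame n (repulsion n b \<eta>)"
  unfolding repulsion_def[abs_def]
  by (intro tame_intros tame_powr) auto

lemma measurable_repulsion [measurable]: "repulsion n b \<eta> \<in> borel_measurable (euclid n)"
  unfolding repulsion_def[abs_def]
  by (intro borel_measurable_prod powr_real_measurable borel_measurable_add borel_measurable_power
     borel_measurable_diff measurable_coord borel_measurable_const) auto

lemma repulsion_mono:
  assumes "b > 0" "0 \<le> \<eta>" "\<eta> \<le> \<eta>'"
  shows "repulsion n b \<eta> x \<le> repulsion n b \<eta>' x"
  unfolding repulsion_def using assms
  by (intro prod_mono conjI prod_nonneg powr_mono2 add_left_mono power_mono) auto

lemma repulsion_exp:
  assumes "\<eta> \<noteq> 0"
  shows "repulsion n b \<eta> x = exp (\<Sum>a\<in>{1..n}. \<Sum>c\<in>{1..n} - {a}. b / 4 * ln ((x a - x c)\<^sup>2 + \<eta>\<^sup>2))"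
proof -
  have "(x a - x c)\<^sup>2 + \<eta>\<^sup>2 > 0" for a c
    using assms by (intro add_nonneg_pos) auto
  then have "((x a - x c)\<^sup>2 + \<eta>\<^sup>2) powr (b / 4) = exp (b / 4 * ln ((x a - x c)\<^sup>2 + \<eta>\<^sup>2))" for a c
    by (metis less_irrefl powr_def)
  then show ?thesis
    unfolding repulsion_def by (simp only: exp_sum finite_atLeastAtMost finite_Diff)
qed

lemma has_partial_repulsion:
  assumes \<eta>: "\<eta> \<noteq> 0"
  shows "has_partial i (repulsion n b \<eta>) (\<lambda>x. repulsion n b \<eta> x * repulsion_force n b \<eta> i x)"
proof -
  have pos: "(x a - x c)\<^sup>2 + \<eta>\<^sup>2 > 0" for a c and x :: "nat \<Rightarrow> real"
    using \<eta> by (intro add_nonneg_pos) auto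
  have "has_partial i (\<lambda>x. exp (\<Sum>a\<in>{1..n}. \<Sum>c\<in>{1..n} - {a}. b / 4 * ln ((x a - x c)\<^sup>2 + \<eta>\<^sup>2)))
    (\<lambda>x. exp (\<Sum>a\<in>{1..n}. \<Sum>c\<in>{1..n} - {a}. b / 4 * ln ((x a - x c)\<^sup>2 + \<eta>\<^sup>2)) *
      (\<Sum>a\<in>{1..n}. \<Sum>c\<in>{1..n} - {a}. b / 4 *
        ((real 2 * (x a - x c) ^ (2 - 1) * ((if a = i then 1 else 0) - (if c = i then 1 else 0)) + 0) / ((x a - x c)\<^sup>2 + \<eta>\<^sup>2))))"
    by (intro has_partial_exp has_partial_sum has_partial_cmult has_partial_ln has_partial_add has_partial_power
        has_partial_diff has_partial_coord has_partial_const pos)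
  then show ?thesis
    unfolding repulsion_exp[OF \<eta>, abs_def]
  proof (rule has_partial_eq)
    have "b / 4 * ((real 2 * d ^ (2 - 1) * s + 0) / q) = b / 2 * d * s / q" for d s q :: real
      by simp
    then show "exp (\<Sum>a\<in>{1..n}. \<Sum>c\<in>{1..n} - {a}. b / 4 * ln ((x a - x c)\<^sup>2 + \<eta>\<^sup>2)) *
      (\<Sum>a\<in>{1..n}. \<Sum>c\<in>{1..n} - {a}. b / 4 *
        ((real 2 * (x a - x c) ^ (2 - 1) * ((if a = i then 1 else 0) - (if c = i then 1 else 0)) + 0) / ((x a - x c)\<^sup>2 + \<eta>\<^sup>2)))
      = exp (\<Sum>a\<in>{1..n}. \<Sum>c\<in>{1..n} - {a}. b / 4 * ln ((x a - x c)\<^sup>2 + \<eta>\<^sup>2)) * repulsion_force n b \<eta> i x" for x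
      unfolding repulsion_force_def by (simp only:)
  qed
qed

lemma tame_repulsion_force [tame_intros]:
  assumes \<eta>: "\<eta> \<noteq> 0"
  shows "tame n (repulsion_force n b \<eta> i)"
  unfolding repulsion_force_def[abs_def]
proof (intro tame_sum)
  fix a c assume ac: "a \<in> {1..n}" "c \<in> {1..n} - {a}"
  let ?s = "(if a = i then 1 else 0) - (if c = i then 1 else 0) :: real"
  have "tame n (\<lambda>x. b / 2 * (x a - x c) * ?s)"
    using ac by (intro tame_intros) auto
  then show "tame n (\<lambda>x. b / 2 * (x a - x c) * ?s / ((x a - x c)\<^sup>2 + \<eta>\<^sup>2))"
  proof (rule tame_bound[where K = "1 / \<eta>\<^sup>2"])
    fix x :: "nat \<Rightarrow> real"
    have "\<bar>u / (v + \<eta>\<^sup>2)\<bar> \<le> 1 / \<eta>\<^sup>2 * \<bar>u\<bar>" if "v \<ge> 0" for u v :: real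
    proof -
      have "\<bar>u\<bar> / (v + \<eta>\<^sup>2) \<le> \<bar>u\<bar> / \<eta>\<^sup>2"
        using \<eta> that by (intro divide_left_mono) (auto intro!: mult_pos_pos add_nonneg_pos)
      then show ?thesis using that by simp
    qed
    then    show "\<bar>b / 2 * (x a - x c) * ?s / ((x a - x c)\<^sup>2 + \<eta>\<^sup>2)\<bar> \<le> 1 / \<eta>\<^sup>2 * \<bar>b / 2 * (x a - x c) * ?s\<bar>"
      by (metis zero_le_power2)
  qed
qed

lemma measurable_repulsion_force [measurable]:
  "repulsion_force n b \<eta> i \<in> borel_measurable (euclid n)"
  unfolding repulsion_force_def[abs_def]
  by (intro borel_measurable_sum borel_measurable_divide borel_measurable_times borel_measurable_add borel_measurable_power
     borel_measurable_diff measurable_coord borel_measurable_const) auto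

text \<open>
  The forces paired with the vector field \<open>y\<^sub>i ^ r\<close>. By antisymmetry each pair contributes a
  multiple of \<open>(y\<^sub>a ^ r - y\<^sub>c ^ r) / (y\<^sub>a - y\<^sub>c)\<close>, damped by the regularisation. This is a polynomial times
  a factor in \<open>[0, 1]\<close>: the singularity has cancelled, and the bound does not depend on \<open>\<eta>\<close>.
\<close>

definition pair_interaction :: "nat \<Rightarrow> real \<Rightarrow> real \<Rightarrow> nat \<Rightarrow> (nat \<Rightarrow> real) \<Rightarrow> real" where
  "pair_interaction n b \<eta> r x = (\<Sum>a\<in>{1..n}. \<Sum>c\<in>{1..n} - {a}.
     b / 2 * ((x a - x c)\<^sup>2 / ((x a - x c)\<^sup>2 + \<eta>\<^sup>2)) * (\<Sum>l<r. (x c + 2) ^ (r - Suc l) * (x a + 2) ^ l))"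

lemma sum_repulsion_force:
  "(\<Sum>i\<in>{1..n}. (x i + 2) ^ r * repulsion_force n b \<eta> i x) = pair_interaction n b \<eta> r x"
proof -
  let ?k = "\<lambda>a c. b / 2 * (x a - x c) / ((x a - x c)\<^sup>2 + \<eta>\<^sup>2)"
  have "(\<Sum>i\<in>{1..n}. (x i + 2) ^ r * repulsion_force n b \<eta> i x) =
    (\<Sum>i\<in>{1..n}. \<Sum>a\<in>{1..n}. \<Sum>c\<in>{1..n} - {a}. ?k a c *
      ((if a = i then (x i + 2) ^ r else 0) - (if c = i then (x i + 2) ^ r else 0)))"
    unfolding repulsion_force_def sum_distrib_left
    by (intro sum.cong refl) (auto simp: mult_ac)
  also have "\<dots> = (\<Sum>a\<in>{1..n}. \<Sum>c\<in>{1..n} - {a}. \<Sum>i\<in>{1..n}. ?k a c *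
      ((if a = i then (x i + 2) ^ r else 0) - (if c = i then (x i + 2) ^ r else 0)))"
    by (subst sum.swap, rule sum.cong[OF refl], rule sum.swap)
  also have "\<dots> = (\<Sum>a\<in>{1..n}. \<Sum>c\<in>{1..n} - {a}. ?k a c * ((x a + 2) ^ r - (x c + 2) ^ r))"
  proof (intro sum.cong refl)
    fix a c assume ac: "a \<in> {1..n}" "c \<in> {1..n} - {a}"
    have "(\<Sum>i\<in>{1..n}. (if a = i then (x i + 2) ^ r else 0) - (if c = i then (x i + 2) ^ r else 0)) = (x a + 2) ^ r - (x c + 2) ^ r"
      using ac by (simp add: sum_subtractf)
    then show "(\<Sum>i\<in>{1..n}. ?k a c * ((if a = i then (x i + 2) ^ r else 0) - (if c = i then (x i + 2) ^ r else 0)))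
        = ?k a c * ((x a + 2) ^ r - (x c + 2) ^ r)"
      by (simp only: sum_distrib_left[symmetric])
  qed
  also have "\<dots> = pair_interaction n b \<eta> r x"
    unfolding pair_interaction_def power_diff_sumr2[of "x _ + 2"]
    by (intro sum.cong refl) (simp add: power2_eq_square)
  finally show ?thesis .
qed

lemma pair_interaction_bound:
  "\<bar>pair_interaction n b \<eta> r x\<bar> \<le>
    (\<Sum>a\<in>{1..n}. \<Sum>c\<in>{1..n} - {a}. \<bar>b / 2\<bar> * \<bar>\<Sum>l<r. (x c + 2) ^ (r - Suc l) * (x a + 2) ^ l\<bar>)"
proof -
  have frac: "\<bar>v / (v + e)\<bar> \<le> 1" if "v \<ge> 0" "e \<ge> 0" for v e :: real
    using that by (cases "v + e = 0") (auto simp: field_simps)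
  have *: "\<bar>k * ((x a - x c)\<^sup>2 / ((x a - x c)\<^sup>2 + \<eta>\<^sup>2)) * q\<bar> \<le> \<bar>k\<bar> * \<bar>q\<bar>" for a c k q
    unfolding abs_mult
    by (rule mult_right_mono, rule mult_right_le_one_le, rule abs_ge_zero, rule abs_ge_zero, rule frac) auto
  show ?thesis
    unfolding pair_interaction_def
    by (rule order_trans[OF sum_abs], rule sum_mono, rule order_trans[OF sum_abs], rule sum_mono, rule *)
qed

lemma measurable_pair_interaction [measurable]:
  "pair_interaction n b \<eta> r \<in> borel_measurable (euclid n)"
  unfolding pair_interaction_def[abs_def]
  by (intro borel_measurable_sum borel_measurable_divide borel_measurable_times borel_measurable_add borel_measurable_power
     borel_measurable_diff measurable_coord borel_measurable_const) auto


section \<open>The loop equations of the ensemble\<close>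

text \<open>
  The part of the divergence of \<open>y\<^sub>i ^ r F\<close> that does not come from the interaction; the last term
  is the force of the quadratic potential.
\<close>

definition drift :: "nat \<Rightarrow> real \<Rightarrow> nat \<Rightarrow> nat list \<Rightarrow> (nat \<Rightarrow> real) \<Rightarrow> real" where
  "drift n \<alpha> r js x = (\<Sum>i\<in>{1..n}. real r * (x i + 2) ^ (r - 1) * mean_prod n js x +
     (x i + 2) ^ r * mean_prod_partial n i js x - \<alpha> * x i * (x i + 2) ^ r * mean_prod n js x)"

lemma tame_drift: "tame n (drift n \<alpha> r js)"
  unfolding drift_def[abs_def] by (intro tame_intros)

lemma measurable_drift [measurable]: "drift n \<alpha> r js \<in> borel_measurable (euclid n)"
  unfolding drift_def[abs_def]
  by (intro borel_measurable_sum borel_measurable_diff borel_measurable_add borel_measurable_times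
      borel_measurable_power borel_measurable_const measurable_coord measurable_mean_prod measurable_mean_prod_partial)

text \<open>
  The field \<open>y\<^sub>i ^ r F\<close>, \<open>F\<close> a product of power means, integrates by parts against the regularised weight
  in each coordinate; the identities are summed over the coordinates.
\<close>

lemma regularized_identity:
  assumes \<eta>: "\<eta> \<noteq> 0" and b: "b > 0" and \<alpha>: "\<alpha> > 0"
  shows "(\<integral>x. (drift n \<alpha> r js x + mean_prod n js x * pair_interaction n b \<eta> r x) * repulsion n b \<eta> x *
     exp (- (\<alpha> / 2) * sq_sum n x) \<partial>euclid n) = 0"
proof -
  let ?F = "mean_prod n js" and ?R = "repulsion n b \<eta>" and ?e = "\<lambda>x. exp (- (\<alpha> / 2) * sq_sum n x)"
  define h' where "h' i x = (real r * (x i + 2) ^ (r - 1) * ?F x + (x i + 2) ^ r * mean_prod_partial n i js x -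
      \<alpha> * x i * (x i + 2) ^ r * ?F x + ?F x * ((x i + 2) ^ r * repulsion_force n b \<eta> i x)) * ?R x" for i x
  have \<alpha>2: "\<alpha> / 2 > 0" using \<alpha> by simp
  have tame': "tame n (h' i)" if "i \<in> {1..n}" for i
    unfolding h'_def by (intro tame_intros that \<eta> b)
  have meas': "h' i \<in> borel_measurable (euclid n)" if "i \<in> {1..n}" for i
    unfolding h'_def
    by (intro borel_measurable_diff borel_measurable_add borel_measurable_times
      borel_measurable_power borel_measurable_const measurable_coord measurable_mean_prod measurable_mean_prod_partial
      measurable_repulsion measurable_repulsion_force that)
  have zero: "(\<integral>x. h' i x * ?e x \<partial>euclid n) = 0" if i: "i \<in> {1..n}" for i
  proof (rule integral_partial_zero[OF i \<alpha>2 _ tame'[OF i] meas'[OF i]])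
    show "tame n (\<lambda>x. (x i + 2) ^ r * ?F x * ?R x)" by (intro tame_intros i b)
    have power: "has_partial i (\<lambda>x. (x i + 2) ^ r) (\<lambda>x. real r * (x i + 2) ^ (r - 1))"
      by (rule has_partial_eq[OF has_partial_power[OF has_partial_add[OF has_partial_coord has_partial_const]]]) simp
    have expand: "((A * F + Y * d) * R + Y * F * (R * f)) * E + Y * F * R * (E * (- (\<alpha> / 2) * (2 * z)))
        = (A * F + Y * d - \<alpha> * z * Y * F + F * (Y * f)) * R * E" for A F Y d R f E z :: real
      by (simp add: algebra_simps)
    show "has_partial i (\<lambda>x. (x i + 2) ^ r * ?F x * ?R x * ?e x) (\<lambda>x. h' i x * ?e x)"
      unfolding h'_def
      by (rule has_partial_eq[OF has_partial_mult[OF has_partial_mult[OF has_partial_mult[OF power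
            has_partial_mean_prod[OF i]] has_partial_repulsion[OF \<eta>]] has_partial_exp[OF has_partial_cmult[OF
            has_partial_sq_sum[OF i]]]]])
         (rule expand)
  qed
  have "(\<integral>x. (drift n \<alpha> r js x + ?F x * pair_interaction n b \<eta> r x) * ?R x * ?e x \<partial>euclid n)
      = (\<integral>x. (\<Sum>i\<in>{1..n}. h' i x * ?e x) \<partial>euclid n)"
    unfolding drift_def h'_def sum_repulsion_force[symmetric] sum_distrib_left[of "mean_prod n js _"] sum.distrib[symmetric]
      sum_distrib_right ..
  also have "\<dots> = (\<Sum>i\<in>{1..n}. \<integral>x. h' i x * ?e x \<partial>euclid n)"
    by (intro Bochner_Integration.integral_sum tame_integrable tame' meas' \<alpha>2)
  also have "\<dots> = 0" using zero by simp
  finally show ?thesis .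
qed

lemma repulsion_tendsto:
  assumes b: "b > 0" and \<eta>: "\<eta> \<longlonglongrightarrow> 0"
  shows "(\<lambda>m. repulsion n b (\<eta> m) x) \<longlonglongrightarrow> repulsion n b 0 x"
  unfolding repulsion_def
proof (intro tendsto_prod)
  fix i j
  show "(\<lambda>m. ((x i - x j)\<^sup>2 + (\<eta> m)\<^sup>2) powr (b / 4)) \<longlonglongrightarrow> ((x i - x j)\<^sup>2 + 0\<^sup>2) powr (b / 4)"
    using b by (intro tendsto_powr' tendsto_intros \<eta>) auto
qed

lemma repulsion_eq_0:
  assumes "a \<in> {1..n}" "c \<in> {1..n} - {a}" "x a = x c"
  shows "repulsion n b 0 x = 0"
proof -
  have "(\<Prod>j\<in>{1..n} - {a}. ((x a - x j)\<^sup>2 + 0\<^sup>2) powr (b / 4)) = 0"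
    using assms by (intro prod_zero bexI[of _ c]) auto
  then have "\<exists>i\<in>{1..n}. (\<Prod>j\<in>{1..n} - {i}. ((x i - x j)\<^sup>2 + 0\<^sup>2) powr (b / 4)) = 0"
    using assms(1) by blast
  from prod_zero[OF finite_atLeastAtMost this] show ?thesis
    unfolding repulsion_def .
qed

text \<open>
  At a collision the damping factor is \<open>0\<close> for every \<open>\<eta>\<close>, in the limit by the convention
  \<open>0 / 0 = 0\<close>; at all other points it tends to \<open>1\<close>.
\<close>

lemma pair_interaction_tendsto:
  assumes \<eta>: "\<eta> \<longlonglongrightarrow> 0"
  shows "(\<lambda>m. pair_interaction n b (\<eta> m) r x) \<longlonglongrightarrow> pair_interaction n b 0 r x"
proof -
  have "(\<lambda>m. d / (d + (\<eta> m)\<^sup>2)) \<longlonglongrightarrow> d / (d + 0\<^sup>2)" for d :: real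
  proof (cases "d = 0")
    case True
    show ?thesis unfolding True by (simp only: div_0 tendsto_const)
  next
    case False
    then have "d + 0\<^sup>2 \<noteq> 0" by simp
    then show ?thesis by (intro tendsto_divide tendsto_add tendsto_power tendsto_const \<eta>)
  qed
  then show ?thesis
    unfolding pair_interaction_def by (intro tendsto_sum tendsto_mult tendsto_const)
qed

text \<open>
  The double sum over all pairs factorises into products of power means; the missing diagonal
  produces the second term.
\<close>

lemma pair_interaction_0:
  assumes n: "n \<ge> 1" and ne: "\<And>a c. a \<in> {1..n} \<Longrightarrow> c \<in> {1..n} - {a} \<Longrightarrow> x a \<noteq> x c"
  shows "pair_interaction n b 0 r x =
     b / 2 * ((real n)\<^sup>2 * (\<Sum>l<r. power_mean n l x * power_mean n (r - 1 - l) x) - real r * real n * power_mean n (r - 1) x)"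
proof -
  define Q where "Q a c = (\<Sum>l<r. (x c + 2) ^ (r - Suc l) * (x a + 2) ^ l)" for a c
  have "pair_interaction n b 0 r x = (\<Sum>a\<in>{1..n}. \<Sum>c\<in>{1..n} - {a}. b / 2 * Q a c)"
    unfolding pair_interaction_def Q_def using ne by (intro sum.cong refl) auto
  also have "\<dots> = b / 2 * ((\<Sum>a\<in>{1..n}. \<Sum>c\<in>{1..n}. Q a c) - (\<Sum>a\<in>{1..n}. Q a a))"
    by (simp add: sum_diff1 sum_subtractf sum_distrib_left right_diff_distrib)
  also have "(\<Sum>a\<in>{1..n}. Q a a) = real r * real n * power_mean n (r - 1) x"
  proof -
    have "Q a a = real r * (x a + 2) ^ (r - 1)" for a
    proof -
      have "Q a a = (\<Sum>l<r. (x a + 2) ^ (r - 1))"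
        unfolding Q_def by (intro sum.cong refl) (auto simp flip: power_add)
      then show ?thesis by simp
    qed
    then have "(\<Sum>a\<in>{1..n}. Q a a) = real r * (\<Sum>a\<in>{1..n}. (x a + 2) ^ (r - 1))"
      by (simp only: sum_distrib_left)
    then show ?thesis using n by (simp add: power_mean_def)
  qed
  also have "(\<Sum>a\<in>{1..n}. \<Sum>c\<in>{1..n}. Q a c) = (\<Sum>l<r. (\<Sum>a\<in>{1..n}. (x a + 2) ^ l) * (\<Sum>c\<in>{1..n}. (x c + 2) ^ (r - 1 - l)))"
  proof -
    have "(\<Sum>a\<in>{1..n}. \<Sum>c\<in>{1..n}. Q a c) = (\<Sum>a\<in>{1..n}. \<Sum>l<r. \<Sum>c\<in>{1..n}. (x c + 2) ^ (r - Suc l) * (x a + 2) ^ l)"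
      unfolding Q_def by (rule sum.cong[OF refl], rule sum.swap)
    also have "\<dots> = (\<Sum>l<r. \<Sum>a\<in>{1..n}. \<Sum>c\<in>{1..n}. (x c + 2) ^ (r - Suc l) * (x a + 2) ^ l)"
      by (rule sum.swap)
    finally show ?thesis by (simp add: sum_product mult.commute)
  qed
  also have "\<dots> = (real n)\<^sup>2 * (\<Sum>l<r. power_mean n l x * power_mean n (r - 1 - l) x)"
  proof -
    have "(\<Sum>i\<in>{1..n}. (x i + 2) ^ j) = real n * power_mean n j x" for j
      using n by (simp add: power_mean_def)
    then show ?thesis by (simp only:) (simp add: sum_distrib_left power2_eq_square mult_ac)
  qed
  finally show ?thesis .
qed

text \<open>
  The regularisation is removed by dominated convergence. The dominating function is available because
  the interaction is bounded independently of \<open>\<eta>\<close> and the repulsion increases with \<open>\<eta>\<close>.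
\<close>

lemma limit_identity:
  assumes b: "b > 0" and \<alpha>: "\<alpha> > 0"
  shows "(\<integral>x. (drift n \<alpha> r js x + mean_prod n js x * pair_interaction n b 0 r x) * repulsion n b 0 x *
     exp (- (\<alpha> / 2) * sq_sum n x) \<partial>euclid n) = 0"
proof -
  let ?F = "mean_prod n js" and ?e = "\<lambda>x. exp (- (\<alpha> / 2) * sq_sum n x)"
  let ?f = "\<lambda>\<eta> x. (drift n \<alpha> r js x + ?F x * pair_interaction n b \<eta> r x) * repulsion n b \<eta> x * ?e x"
  define \<eta> where "\<eta> m = inverse (real (Suc m))" for m
  have \<eta>0: "\<eta> \<longlonglongrightarrow> 0" unfolding \<eta>_def by (rule LIMSEQ_inverse_real_of_nat)
  have \<eta>: "0 < \<eta> m" "\<eta> m \<le> 1" for m unfolding \<eta>_def by (auto simp: inverse_le_1_iff)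
  define B where "B x = (\<Sum>a\<in>{1..n}. \<Sum>c\<in>{1..n} - {a}. \<bar>b / 2\<bar> * \<bar>\<Sum>l<r. (x c + 2) ^ (r - Suc l) * (x a + 2) ^ l\<bar>)" for x
  define w where "w x = (\<bar>drift n \<alpha> r js x\<bar> + \<bar>?F x\<bar> * B x) * repulsion n b 1 x" for x
  have "(\<lambda>m. \<integral>x. ?f (\<eta> m) x \<partial>euclid n) \<longlonglongrightarrow> (\<integral>x. ?f 0 x \<partial>euclid n)"
  proof (rule integral_dominated_convergence[where w = "\<lambda>x. w x * ?e x"])
    show "?f \<eta> \<in> borel_measurable (euclid n)" for \<eta> by measurable
    then show "?f \<eta> \<in> borel_measurable (euclid n)" for \<eta> .
    have [measurable]: "B \<in> borel_measurable (euclid n)"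
      unfolding B_def[abs_def]
      by (intro borel_measurable_sum borel_measurable_times borel_measurable_abs borel_measurable_add
         borel_measurable_power measurable_coord borel_measurable_const) auto
    have "tame n w" unfolding w_def[abs_def] B_def[abs_def]
      by (intro tame_intros tame_drift b) auto
    moreover have "w \<in> borel_measurable (euclid n)" unfolding w_def[abs_def] by measurable
    ultimately show "integrable (euclid n) (\<lambda>x. w x * ?e x)"
      using \<alpha> by (intro tame_integrable) auto
    show "AE x in euclid n. norm (?f (\<eta> m) x) \<le> w x * ?e x" for m
    proof (rule AE_I2)
      fix x :: "nat \<Rightarrow> real"
      have "\<bar>drift n \<alpha> r js x + ?F x * pair_interaction n b (\<eta> m) r x\<bar> \<le> \<bar>drift n \<alpha> r js x\<bar> + \<bar>?F x\<bar> * B x"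
        using mult_left_mono[OF pair_interaction_bound[of n b "\<eta> m" r x, folded B_def] abs_ge_zero[of "?F x"]]
          abs_triangle_ineq[of "drift n \<alpha> r js x" "?F x * pair_interaction n b (\<eta> m) r x"]
        unfolding abs_mult by linarith
      moreover have "repulsion n b (\<eta> m) x \<le> repulsion n b 1 x"
        using \<eta>[of m] by (intro repulsion_mono b) auto
      ultimately have "\<bar>drift n \<alpha> r js x + ?F x * pair_interaction n b (\<eta> m) r x\<bar> * repulsion n b (\<eta> m) x \<le> w x"
        unfolding w_def by (intro mult_mono) auto
      then show "norm (?f (\<eta> m) x) \<le> w x * ?e x"
        by (simp add: abs_mult)
    qed
    show "AE x in euclid n. (\<lambda>m. ?f (\<eta> m) x) \<longlonglongrightarrow> ?f 0 x"
    proof (rule AE_I2)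
      fix x :: "nat \<Rightarrow> real"
      show "(\<lambda>m. ?f (\<eta> m) x) \<longlonglongrightarrow> ?f 0 x"
        by (intro tendsto_add tendsto_mult tendsto_const repulsion_tendsto pair_interaction_tendsto b \<eta>0)
    qed
  qed
  moreover have "(\<integral>x. ?f (\<eta> m) x \<partial>euclid n) = 0" for m
    using \<eta>[of m] by (intro regularized_identity b \<alpha>) auto
  ultimately have "(\<lambda>m::nat. 0) \<longlonglongrightarrow> (\<integral>x. ?f 0 x \<partial>euclid n)"
    by (simp only:)
  then show ?thesis by (rule LIMSEQ_unique[OF _ tendsto_const])
qed

text \<open>
  Dividing the identity by \<open>n * \<alpha>\<close> turns it into a relation between products of power means. Since
  \<open>y\<^sub>i = x\<^sub>i + 2\<close>, the potential contributes \<open>power_mean (r + 1) - 2 * power_mean r\<close>, and the choice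
  \<open>\<alpha> = n * b / 2\<close> gives the convolution coefficient \<open>1\<close>.
\<close>

lemma loop_identity:
  assumes n: "n \<ge> 1" and b: "b > 0" and \<alpha>: "\<alpha> = real n * b / 2"
  shows "(\<integral>x. (2 * mean_prod n (r # js) x + (\<Sum>l<r. mean_prod n (l # (r - 1 - l) # js) x)
     + real r * ((2 / b - 1) / real n) * mean_prod n ((r - 1) # js) x
     + 2 / ((real n)\<^sup>2 * b) * (\<Sum>s<length js. real (js ! s) * mean_prod n (js[s := r + js ! s - 1]) x)
     - mean_prod n (Suc r # js) x) * gbe_weight n \<alpha> b x \<partial>euclid n) = 0"
    (is "(\<integral>x. ?L x * gbe_weight n \<alpha> b x \<partial>euclid n) = 0")
proof -
  have \<alpha>pos: "\<alpha> > 0" unfolding \<alpha> using n b by simp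
  have eq: "(drift n \<alpha> r js x + mean_prod n js x * pair_interaction n b 0 r x) * repulsion n b 0 x
      = real n * \<alpha> * ?L x * repulsion n b 0 x" for x
    \<comment> \<open>At a collision both sides vanish; elsewhere the undamped interaction is the full double sum.\<close>
  proof (cases "repulsion n b 0 x = 0")
    case False
    have ne: "x a \<noteq> x c" if "a \<in> {1..n}" "c \<in> {1..n} - {a}" for a c
    proof
    assume "x a = x c"
    with False repulsion_eq_0[of a n c x b] that show False by blast
  qed
    define p where "p j = power_mean n j x" for j
    define F where "F = mean_prod n js x"
    define S where "S = (\<Sum>s<length js. real (js ! s) * mean_prod n (js[s := r + js ! s - 1]) x)"
    define C where "C = (\<Sum>l<r. p l * p (r - 1 - l))"
    have mean: "(\<Sum>i\<in>{1..n}. (x i + 2) ^ j) = real n * p j" for j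
      using n by (simp add: p_def power_mean_def)
    have "drift n \<alpha> r js x = real r * F * (\<Sum>i\<in>{1..n}. (x i + 2) ^ (r - 1)) + S
       - \<alpha> * F * ((\<Sum>i\<in>{1..n}. (x i + 2) ^ Suc r) - 2 * (\<Sum>i\<in>{1..n}. (x i + 2) ^ r))"
    proof -
      have "drift n \<alpha> r js x = (\<Sum>i\<in>{1..n}. real r * F * (x i + 2) ^ (r - 1) + (x i + 2) ^ r * mean_prod_partial n i js x
          - \<alpha> * F * ((x i + 2) ^ Suc r - 2 * (x i + 2) ^ r))"
        unfolding drift_def F_def by (rule sum.cong[OF refl]) (simp add: algebra_simps)
      then show ?thesis
        unfolding S_def sum_mean_prod_partial[symmetric]
        by (simp only: sum.distrib sum_subtractf sum_distrib_left right_diff_distrib)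
    qed
    then have drift: "drift n \<alpha> r js x = real r * F * (real n * p (r - 1)) + S
       - \<alpha> * F * (real n * p (Suc r) - 2 * (real n * p r))"
      unfolding mean .
    have inter: "pair_interaction n b 0 r x = b / 2 * ((real n)\<^sup>2 * C - real r * real n * p (r - 1))"
      using pair_interaction_0[OF n ne] by (simp add: p_def C_def)
    have L: "?L x = 2 * (p r * F) + C * F + real r * ((2 / b - 1) / real n) * (p (r - 1) * F)
        + 2 / ((real n)\<^sup>2 * b) * S - p (Suc r) * F"
      by (simp add: p_def F_def S_def C_def sum_distrib_right mult.assoc)
    have coeffs: "real n * \<alpha> * ((2 / b - 1) / real n) = real n * (1 - b / 2)"
      "real n * \<alpha> * (2 / ((real n)\<^sup>2 * b)) = 1"
      using n b by (simp_all add: \<alpha> field_simps power2_eq_square)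
    have expand: "N * (2 * u + v + k * g * w + d * s - z) = N * 2 * u + N * v + k * (N * g) * w + (N * d) * s - N * z"
      for N u v k g w d s z :: real by (simp add: algebra_simps)
    have "drift n \<alpha> r js x + F * pair_interaction n b 0 r x = real n * \<alpha> * ?L x"
      unfolding drift inter L expand coeffs
      by (simp add: \<alpha> algebra_simps power2_eq_square)
    then show ?thesis by (simp add: F_def)
  qed simp
  have "(\<integral>x. real n * \<alpha> * (?L x * gbe_weight n \<alpha> b x) \<partial>euclid n) = 0"
    using limit_identity[OF b \<alpha>pos, of n r js] unfolding eq gbe_weight_eq by (simp only: mult.assoc)
  then have "real n * \<alpha> * (\<integral>x. ?L x * gbe_weight n \<alpha> b x \<partial>euclid n) = 0"
    by (subst (asm) integral_mult_right_zero)
  moreover have "real n * \<alpha> \<noteq> 0" using n \<alpha>pos by simp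
  moreover have "v = 0" if "u * v = 0" "u \<noteq> 0" for u v :: real using that by simp
  ultimately show ?thesis by blast
qed

lemma measurable_gbe_weight [measurable]: "gbe_weight n \<alpha> b \<in> borel_measurable (euclid n)"
  unfolding gbe_weight_eq[abs_def] by measurable

lemma gbe_weight_nonneg: "gbe_weight n \<alpha> b x \<ge> 0"
  by (simp add: gbe_weight_eq)

lemma gbe_Z_nonneg: "gbe_Z n \<alpha> b \<ge> 0"
  unfolding gbe_Z_def by (simp add: gbe_weight_nonneg)

lemma sets_gbe [measurable_cong, simp]: "sets (gbe n \<alpha> b) = sets (euclid n)"
  by (simp add: gbe_def)

lemma space_gbe: "space (gbe n \<alpha> b) = space (euclid n)"
  by (simp add: gbe_def)

lemma integral_gbe:
  assumes h: "h \<in> borel_measurable (euclid n)"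
  shows "(\<integral>x. h x \<partial>gbe n \<alpha> b) = (\<integral>x. h x * gbe_weight n \<alpha> b x \<partial>euclid n) / gbe_Z n \<alpha> b"
proof -
  have "(\<lambda>x. gbe_weight n \<alpha> b x / gbe_Z n \<alpha> b) \<in> borel_measurable (euclid n)"
    by measurable
  from integral_density[OF h this] show ?thesis
    unfolding gbe_def by (simp add: gbe_weight_nonneg gbe_Z_nonneg mult.commute)
qed

lemma integrable_gbe:
  assumes [measurable]: "h \<in> borel_measurable (euclid n)" and h: "tame n h" and b: "b > 0" and \<alpha>: "\<alpha> > 0"
  shows "integrable (gbe n \<alpha> b) h"
proof -
  have "integrable (euclid n) (\<lambda>x. (1 / gbe_Z n \<alpha> b * (h x * repulsion n b 0 x)) * exp (- (\<alpha> / 2) * sq_sum n x))"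
    using \<alpha> by (intro tame_integrable tame_intros h b borel_measurable_times borel_measurable_const
       assms(1) measurable_repulsion) auto
  then have "integrable (euclid n) (\<lambda>x. gbe_weight n \<alpha> b x / gbe_Z n \<alpha> b * h x)"
    by (simp add: gbe_weight_eq mult_ac)
  moreover have "(\<lambda>x. gbe_weight n \<alpha> b x / gbe_Z n \<alpha> b) \<in> borel_measurable (euclid n)"
    by measurable
  ultimately show ?thesis
    unfolding gbe_def using integrable_density[OF assms(1), of "\<lambda>x. gbe_weight n \<alpha> b x / gbe_Z n \<alpha> b"]
    by (simp add: gbe_weight_nonneg gbe_Z_nonneg)
qed

lemma gbe_loop_system:
  assumes n: "n \<ge> 1" and b: "b > 0" and \<alpha>: "\<alpha> = real n * b / 2"
    and prob: "prob_space (gbe n \<alpha> b)"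
  shows "loop_system ((2 / b - 1) / real n) (2 / ((real n)\<^sup>2 * b)) (\<lambda>js. \<integral>x. mean_prod n js x \<partial>gbe n \<alpha> b)"
  unfolding loop_system_def
proof (intro conjI allI)
  show "(\<integral>x. mean_prod n [] x \<partial>gbe n \<alpha> b) = 1"
    using prob by (simp add: prob_space.prob_space)
  show "(\<integral>x. mean_prod n (0 # js) x \<partial>gbe n \<alpha> b) = (\<integral>x. mean_prod n js x \<partial>gbe n \<alpha> b)" for js
    using n by (simp add: power_mean_0)
  fix r js
  have int: "integrable (gbe n \<alpha> b) (mean_prod n ks)" for ks
    using n b by (intro integrable_gbe tame_intros measurable_mean_prod) (auto simp: \<alpha>)
  let ?L = "\<lambda>x. 2 * mean_prod n (r # js) x + (\<Sum>l<r. mean_prod n (l # (r - 1 - l) # js) x)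
     + real r * ((2 / b - 1) / real n) * mean_prod n ((r - 1) # js) x
     + 2 / ((real n)\<^sup>2 * b) * (\<Sum>s<length js. real (js ! s) * mean_prod n (js[s := r + js ! s - 1]) x)
     - mean_prod n (Suc r # js) x"
  have "(\<lambda>x. ?L x) \<in> borel_measurable (euclid n)"
    by (intro borel_measurable_diff borel_measurable_add borel_measurable_times borel_measurable_sum
       borel_measurable_const measurable_mean_prod)
  then have "(\<integral>x. ?L x \<partial>gbe n \<alpha> b) = 0"
    by (subst integral_gbe) (auto simp only: loop_identity[OF n b \<alpha>] div_0)
  moreover have "(\<integral>x. ?L x \<partial>gbe n \<alpha> b) =
      2 * (\<integral>x. mean_prod n (r # js) x \<partial>gbe n \<alpha> b) + (\<Sum>l<r. \<integral>x. mean_prod n (l # (r - 1 - l) # js) x \<partial>gbe n \<alpha> b)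
     + real r * ((2 / b - 1) / real n) * (\<integral>x. mean_prod n ((r - 1) # js) x \<partial>gbe n \<alpha> b)
     + 2 / ((real n)\<^sup>2 * b) * (\<Sum>s<length js. real (js ! s) * (\<integral>x. mean_prod n (js[s := r + js ! s - 1]) x \<partial>gbe n \<alpha> b))
     - (\<integral>x. mean_prod n (Suc r # js) x \<partial>gbe n \<alpha> b)"
    by (simp only: Bochner_Integration.integral_diff Bochner_Integration.integral_add Bochner_Integration.integral_sum
         integral_mult_right_zero Bochner_Integration.integrable_diff Bochner_Integration.integrable_add Bochner_Integration.integrable_sum integrable_mult_right int)
  ultimately show "(\<integral>x. mean_prod n (Suc r # js) x \<partial>gbe n \<alpha> b) =
      2 * (\<integral>x. mean_prod n (r # js) x \<partial>gbe n \<alpha> b) + (\<Sum>l<r. \<integral>x. mean_prod n (l # (r - 1 - l) # js) x \<partial>gbe n \<alpha> b)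
     + real r * ((2 / b - 1) / real n) * (\<integral>x. mean_prod n ((r - 1) # js) x \<partial>gbe n \<alpha> b)
     + 2 / ((real n)\<^sup>2 * b) * (\<Sum>s<length js. real (js ! s) * (\<integral>x. mean_prod n (js[s := r + js ! s - 1]) x \<partial>gbe n \<alpha> b))"
    by linarith
qed


section \<open>The edge of the spectrum\<close>

locale vanishing_beta_ensemble =
  fixes \<alpha> \<beta> :: "nat \<Rightarrow> real"
  assumes \<beta>_pos: "\<And>n. n \<ge> 1 \<Longrightarrow> \<beta> n > 0"
    and \<beta>_lower: "(\<lambda>n. ln (real n) / real n) \<lless> \<beta>"
    and \<beta>_upper: "\<beta> \<lless> (\<lambda>n. 1 / ln (real n))"
    and \<alpha>_eq: "\<And>n. n \<ge> 1 \<Longrightarrow> \<alpha> n = real n * \<beta> n / 2"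
    and prob_gbe: "\<And>n. n \<ge> 1 \<Longrightarrow> prob_space (gbe n (\<alpha> n) (\<beta> n))"
begin

abbreviation G :: "nat \<Rightarrow> (nat \<Rightarrow> real) measure" where
  "G n \<equiv> gbe n (\<alpha> n) (\<beta> n)"

definition W :: "nat \<Rightarrow> nat list \<Rightarrow> real" where
  "W n js = (\<integral>x. mean_prod n js x \<partial>G n)"

text \<open>
  Up to a constant, the ratio of entropy to energy per particle; the lower bound on \<open>\<beta>\<close> says that it
  is small compared with \<open>1 / ln n\<close>.
\<close>

abbreviation \<kappa> :: "nat \<Rightarrow> real" where
  "\<kappa> n \<equiv> 1 / (real n * \<beta> n)"

lemma ln_\<kappa>_tendsto: "(\<lambda>n. ln (real n) * \<kappa> n) \<longlonglongrightarrow> 0"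
  using \<beta>_lower by (simp add: much_less_def)

lemma \<kappa>_tendsto: "\<kappa> \<longlonglongrightarrow> 0"
proof -
  have "(\<lambda>n. ln (real n) * \<kappa> n * (1 / ln (real n))) \<longlonglongrightarrow> 0 * 0"
    by (intro tendsto_mult ln_\<kappa>_tendsto) real_asymp
  moreover have "eventually (\<lambda>n. ln (real n) * \<kappa> n * (1 / ln (real n)) = \<kappa> n) sequentially"
    using eventually_ge_at_top[of 2] by eventually_elim auto
  ultimately show ?thesis by (simp add: tendsto_cong)
qed

text \<open>
  This makes the coefficient \<open>\<gamma>\<close> of the loop recursion nonnegative.
\<close>

lemma \<beta>_le_2: "eventually (\<lambda>n. \<beta> n \<le> 2) sequentially"
proof -
  have "(\<lambda>n. \<beta> n * ln (real n)) \<longlonglongrightarrow> 0"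
    using \<beta>_upper by (simp add: much_less_def)
  then have "eventually (\<lambda>n. \<beta> n * ln (real n) < 2) sequentially"
    by (rule order_tendstoD) simp
  moreover have "eventually (\<lambda>n. ln (real n) \<ge> 1) sequentially" by real_asymp
  ultimately show ?thesis using eventually_ge_at_top[of 1]
  proof eventually_elim
    case (elim n)
    then have "\<beta> n * 1 \<le> \<beta> n * ln (real n)" using \<beta>_pos[of n] by (intro mult_left_mono) auto
    with elim show ?case by linarith
  qed
qed

abbreviation \<gamma> :: "nat \<Rightarrow> real" where "\<gamma> n \<equiv> (2 / \<beta> n - 1) / real n"
abbreviation \<delta> :: "nat \<Rightarrow> real" where "\<delta> n \<equiv> 2 / ((real n)\<^sup>2 * \<beta> n)"

lemma loop_W: "n \<ge> 1 \<Longrightarrow> loop_system (\<gamma> n) (\<delta> n) (W n)"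
  unfolding W_def using gbe_loop_system[OF _ \<beta>_pos \<alpha>_eq prob_gbe] by simp

lemma \<gamma>_\<kappa>: "\<gamma> n = 2 * \<kappa> n - 1 / real n"
  by (simp add: diff_divide_distrib)

lemma \<delta>_\<kappa>: "\<delta> n = 2 * \<kappa> n * (1 / real n)"
  by (simp add: power2_eq_square)

lemma \<gamma>_tendsto: "\<gamma> \<longlonglongrightarrow> 0"
proof -
  have "(\<lambda>n. 2 * \<kappa> n - 1 / real n) \<longlonglongrightarrow> 2 * 0 - 0"
    by (intro tendsto_diff tendsto_mult tendsto_const \<kappa>_tendsto lim_1_over_n)
  then show ?thesis unfolding \<gamma>_\<kappa> by simp
qed

lemma \<delta>_tendsto: "\<delta> \<longlonglongrightarrow> 0"
proof -
  have "(\<lambda>n. 2 * \<kappa> n * (1 / real n)) \<longlonglongrightarrow> 2 * 0 * 0"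
    by (intro tendsto_mult tendsto_const \<kappa>_tendsto lim_1_over_n)
  then show ?thesis unfolding \<delta>_\<kappa> by simp
qed

lemma W_tendsto: "(\<lambda>n. W n js) \<longlonglongrightarrow> prod_list (map (\<lambda>j. catalan (Suc j)) js)"
  by (rule loop_system_tendsto[OF _ \<gamma>_tendsto \<delta>_tendsto])
     (rule eventually_mono[OF eventually_ge_at_top[of 1] loop_W])

lemma integrable_mean_prod:
  assumes "n \<ge> 1"
  shows "integrable (G n) (mean_prod n js)"
  using assms \<beta>_pos[of n] by (intro integrable_gbe tame_intros measurable_mean_prod) (auto simp: \<alpha>_eq)

lemma integrable_power_mean: "n \<ge> 1 \<Longrightarrow> integrable (G n) (power_mean n j)"
  using integrable_mean_prod[of n "[j]"] by (simp add: mean_prod_fun)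

lemma integral_power_mean: "(\<integral>x. power_mean n j x \<partial>G n) = W n [j]"
  by (simp add: W_def)

lemma integrable_power_mean_mult: "n \<ge> 1 \<Longrightarrow> integrable (G n) (\<lambda>x. power_mean n i x * power_mean n j x)"
  using integrable_mean_prod[of n "[i, j]"] by (simp add: mean_prod_fun)

lemma integral_power_mean_mult: "(\<integral>x. power_mean n i x * power_mean n j x \<partial>G n) = W n [i, j]"
  by (simp add: W_def)

text \<open>
  Moments of order \<open>O(ln n)\<close> still grow at a rate arbitrarily close to \<open>4\<close>: the total error
  collected over so many steps is of order \<open>\<kappa> * ln n\<close>, which tends to zero. The lower
  bound on \<open>\<beta>\<close> is what makes it vanish.
\<close>

lemma large_moment_bound:
  assumes R: "R > 1" and c: "c \<ge> 0" and K: "\<And>n. n \<ge> 1 \<Longrightarrow> real (K n) \<le> c * ln (real n) + 2"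
  shows "eventually (\<lambda>n. W n [K n] \<le> 4 * (4 * R) ^ K n) sequentially"
proof -
  define B where "B n = 2 * (c * (ln (real n) * \<kappa> n) + 2 * \<kappa> n) * (1 + (c * ln (real n) + 4)\<^sup>2 / real n)" for n
  have "(\<lambda>n. c\<^sup>2 * ((ln (real n))\<^sup>2 / real n) + 8 * c * (ln (real n) / real n) + 16 / real n) \<longlonglongrightarrow> c\<^sup>2 * 0 + 8 * c * 0 + 0"
    by (intro tendsto_add tendsto_mult tendsto_const) real_asymp+
  then have "(\<lambda>n. (c * ln (real n) + 4)\<^sup>2 / real n) \<longlonglongrightarrow> 0"
    by (simp add: power2_eq_square algebra_simps add_divide_distrib)
  then have "B \<longlonglongrightarrow> 2 * (c * 0 + 2 * 0) * (1 + 0)"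
    unfolding B_def by (intro tendsto_mult tendsto_add tendsto_const ln_\<kappa>_tendsto \<kappa>_tendsto)
  then have "eventually (\<lambda>n. B n < R - 1) sequentially"
    using R by (intro order_tendstoD(2)[of B 0]) auto
  then show ?thesis using \<beta>_le_2 eventually_ge_at_top[of 1]
  proof eventually_elim
    case (elim n)
    have \<beta>: "\<beta> n > 0" using \<beta>_pos elim by simp
    have \<kappa>: "\<kappa> n \<ge> 0" using \<beta> by simp
    have \<gamma>: "\<gamma> n \<ge> 0" using \<beta> elim by (auto simp: divide_simps)
    have Kn: "real (K n) \<le> c * ln (real n) + 2" using K elim by simp
    have "real (K n) * \<gamma> n + \<delta> n * real (K n) * (real (K n) + 2)\<^sup>2
        \<le> real (K n) * (2 * \<kappa> n) + \<delta> n * real (K n) * (real (K n) + 2)\<^sup>2"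
      unfolding \<gamma>_\<kappa> by (intro add_right_mono mult_left_mono) auto
    also have "\<dots> = 2 * (real (K n) * \<kappa> n) * (1 + (real (K n) + 2)\<^sup>2 / real n)"
      unfolding \<delta>_\<kappa> by (simp add: algebra_simps)
    also have "\<dots> \<le> 2 * ((c * ln (real n) + 2) * \<kappa> n) * (1 + (c * ln (real n) + 4)\<^sup>2 / real n)"
      using Kn \<kappa> by (intro mult_mono mult_left_mono mult_right_mono add_left_mono divide_right_mono power_mono) auto
    also have "\<dots> = B n" unfolding B_def by (simp add: algebra_simps)
    also have "\<dots> \<le> R - 1" using elim by simp
    finally have small: "1 + real (K n) * \<gamma> n + \<delta> n * real (K n) * (real (K n) + 2)\<^sup>2 \<le> R" by simp
    have "W n [K n] \<le> prod_list (map (\<lambda>j. R ^ j * catalan (Suc j)) [K n])"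
      by (rule loop_system_upper_bound[OF loop_W \<gamma> _ _ small]) (use elim \<beta> R in auto)
    also have "\<dots> = R ^ K n * catalan (Suc (K n))" by simp
    also have "\<dots> \<le> R ^ K n * 4 ^ Suc (K n)"
      using catalan_add_le[of "Suc (K n)" 0] R by (intro mult_left_mono) auto
    finally show ?case by (simp add: power_mult_distrib mult_ac)
  qed
qed

text \<open>
  A single large eigenvalue contributes only a fraction \<open>1 / n\<close> to a power mean. A moment
  of order \<open>C * ln n\<close> amplifies the excess over \<open>4\<close> to a power of \<open>n\<close> that outweighs this factor.
\<close>

lemma upper_tail:
  assumes \<epsilon>: "\<epsilon> > 0"
  shows "(\<lambda>n. measure (G n) {x \<in> space (G n). \<exists>i\<in>{1..n}. x i > 2 + \<epsilon>}) \<longlonglongrightarrow> 0"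
proof -
  \<comment> \<open>The growth rate \<open>4 * R\<close> is \<open>4 + \<epsilon> / 2\<close>, strictly below the threshold \<open>4 + \<epsilon>\<close>.\<close>
  define R where "R = 1 + \<epsilon> / 8"
  define \<rho> where "\<rho> = (4 + \<epsilon>) / (4 * R)"
  \<comment> \<open>The order is even, so that powers are nonnegative, and large enough for \<open>\<rho> ^ K n \<ge> n\<^sup>2\<close>: one
    factor \<open>n\<close> is lost in the mean, the other makes the bound tend to zero.\<close>
  define K where "K n = 2 * nat \<lceil>ln (real n) / ln \<rho>\<rceil>" for n
  have R: "R > 1" using \<epsilon> by (simp add: R_def)
  have \<rho>: "\<rho> > 1" using \<epsilon> by (simp add: \<rho>_def R_def)
  then have ln\<rho>: "ln \<rho> > 0" by simp
  have K_upper: "real (K n) \<le> 2 / ln \<rho> * ln (real n) + 2" if "n \<ge> 1" for n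
  proof -
    have "ln (real n) / ln \<rho> \<ge> 0" using that ln\<rho> by simp
    then have "real (nat \<lceil>ln (real n) / ln \<rho>\<rceil>) \<le> ln (real n) / ln \<rho> + 1"
      by linarith
    then show ?thesis by (simp add: K_def)
  qed
  have K_lower: "(real n)\<^sup>2 \<le> \<rho> ^ K n" if "n \<ge> 1" for n
  proof -
    have "2 * (ln (real n) / ln \<rho>) \<le> real (K n)" unfolding K_def
      using real_nat_ceiling_ge[of "ln (real n) / ln \<rho>"] by simp
    then have "2 * ln (real n) \<le> real (K n) * ln \<rho>" using ln\<rho> by (simp add: field_simps)
    then have "exp (2 * ln (real n)) \<le> exp (real (K n) * ln \<rho>)" by simp
    then show ?thesis using that \<rho> by (simp add: exp_of_nat_mult exp_double)
  qed
  have large: "eventually (\<lambda>n. W n [K n] \<le> 4 * (4 * R) ^ K n) sequentially"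
    by (rule large_moment_bound[OF R _ K_upper]) (use ln\<rho> in simp_all)
  have "eventually (\<lambda>n. measure (G n) {x \<in> space (G n). \<exists>i\<in>{1..n}. x i > 2 + \<epsilon>} \<le> 4 / real n) sequentially"
    using large eventually_ge_at_top[of 1]
  proof eventually_elim
    case (elim n)
    note n = elim(2) and WK = elim(1)
    interpret prob_space "G n" by (rule prob_gbe[OF n])
    have nonneg: "(x i + 2) ^ K n \<ge> 0" for x :: "nat \<Rightarrow> real" and i by (simp add: K_def)
    let ?t = "(4 + \<epsilon>) ^ K n / real n"
    have t: "?t > 0" using n \<epsilon> by simp
    have sets: "{x \<in> space (G n). power_mean n (K n) x \<ge> ?t} \<in> sets (G n)"
      by measurable
    have "{x \<in> space (G n). \<exists>i\<in>{1..n}. x i > 2 + \<epsilon>} \<subseteq> {x \<in> space (G n). power_mean n (K n) x \<ge> ?t}"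
    proof safe
      fix x :: "nat \<Rightarrow> real" and i assume i: "i \<in> {1..n}" and x: "x i > 2 + \<epsilon>"
      have "(4 + \<epsilon>) ^ K n \<le> (x i + 2) ^ K n" using x \<epsilon> by (intro power_mono) auto
      also have "\<dots> \<le> (\<Sum>i\<in>{1..n}. (x i + 2) ^ K n)" using i nonneg by (intro member_le_sum) auto
      finally show "power_mean n (K n) x \<ge> ?t" unfolding power_mean_def by (rule divide_right_mono) simp
    qed
    then have "measure (G n) {x \<in> space (G n). \<exists>i\<in>{1..n}. x i > 2 + \<epsilon>} \<le> measure (G n) {x \<in> space (G n). power_mean n (K n) x \<ge> ?t}"
      by (intro finite_measure_mono sets)
    also have "\<dots> \<le> (\<integral>x. power_mean n (K n) x \<partial>G n) / ?t"
      by (rule integral_Markov_inequality_measure[OF integrable_power_mean[OF n] sets _ t])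
         (simp add: power_mean_def nonneg sum_nonneg)
    also have "\<dots> = W n [K n] / ?t" by (simp only: integral_power_mean)
    also have "\<dots> \<le> 4 * (4 * R) ^ K n / ?t" using t by (intro divide_right_mono WK) simp
    also have "\<dots> = 4 * real n / \<rho> ^ K n"
      unfolding \<rho>_def power_divide divide_divide_eq_right by (simp only: mult_ac)
    also have "\<dots> \<le> 4 * real n / (real n)\<^sup>2"
      by (rule divide_left_mono[OF K_lower[OF n]]) (use n \<rho> in simp_all)
    also have "\<dots> = 4 / real n" using n by (simp add: power2_eq_square)
    finally show ?case .
  qed
  moreover have lim: "(\<lambda>n. 4 / real n) \<longlonglongrightarrow> 0" by real_asymp
  ultimately show ?thesis
    by (intro tendsto_sandwich[OF _ _ tendsto_const lim]) simp_all
qed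

text \<open>
  If all \<open>y\<^sub>i = x\<^sub>i + 2\<close> are below \<open>a = 4 - \<epsilon>\<close>, the statistic \<open>X\<close>, the mean of
  \<open>y\<^sub>i ^ k * (y\<^sub>i - a)\<close> with \<open>k\<close> even, is nonpositive. But by the limits of the first and second moments
  \<open>X\<close> converges in mean square to \<open>c = catalan (k + 2) - a * catalan (k + 1)\<close>, and \<open>c\<close> is positive for large \<open>k\<close>
  because the ratio of consecutive Catalan numbers tends to \<open>4 > a\<close>.
\<close>

lemma lower_tail:
  assumes \<epsilon>: "\<epsilon> > 0"
  shows "(\<lambda>n. measure (G n) {x \<in> space (G n). \<forall>i\<in>{1..n}. x i < 2 - \<epsilon>}) \<longlonglongrightarrow> 0"
proof -
  \<comment> \<open>The ratio of the two Catalan numbers in \<open>c\<close> is \<open>4 - 6 / (k + 3)\<close>.\<close>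
  define k where "k = 2 * nat \<lceil>6 / \<epsilon>\<rceil>"
  define a where "a = 4 - \<epsilon>"
  define c where "c = catalan (k + 2) - a * catalan (k + 1)"
  have c: "c > 0"
  proof -
    have "6 / \<epsilon> \<le> real k" unfolding k_def using real_nat_ceiling_ge[of "6 / \<epsilon>"] by simp
    then have "6 < \<epsilon> * (real k + 3)" using \<epsilon> by (simp add: field_simps)
    then have "(real k + 3) * a < 4 * real k + 6" by (simp add: a_def algebra_simps)
    then have "(real k + 3) * a * catalan (k + 1) < (4 * real k + 6) * catalan (k + 1)"
      using catalan_pos by (intro mult_strict_right_mono)
    also have "\<dots> = (real k + 3) * catalan (k + 2)"
      using catalan_ratio[of "k + 1"] by (simp add: add.commute)
    finally show ?thesis by (simp add: c_def mult.assoc)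
  qed
  define X where "X n x = power_mean n (k + 1) x - a * power_mean n k x" for n x
  have second: "(\<integral>x. (X n x - c)\<^sup>2 \<partial>G n) = W n [k + 1, k + 1] - 2 * a * W n [k + 1, k] + a\<^sup>2 * W n [k, k]
      - 2 * c * W n [k + 1] + 2 * c * a * W n [k] + c\<^sup>2"
    and int: "integrable (G n) (\<lambda>x. (X n x - c)\<^sup>2)" if n: "n \<ge> 1" for n
  proof -
    interpret prob_space "G n" by (rule prob_gbe[OF n])
    have "(\<lambda>x. (X n x - c)\<^sup>2) = (\<lambda>x. power_mean n (k + 1) x * power_mean n (k + 1) x
      - 2 * a * (power_mean n (k + 1) x * power_mean n k x) + a\<^sup>2 * (power_mean n k x * power_mean n k x)
      - 2 * c * power_mean n (k + 1) x + 2 * c * a * power_mean n k x + c\<^sup>2)"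
      by (auto simp: X_def power2_eq_square algebra_simps)
    moreover have "has_bochner_integral (G n) (\<lambda>x. power_mean n (k + 1) x * power_mean n (k + 1) x
      - 2 * a * (power_mean n (k + 1) x * power_mean n k x) + a\<^sup>2 * (power_mean n k x * power_mean n k x)
      - 2 * c * power_mean n (k + 1) x + 2 * c * a * power_mean n k x + c\<^sup>2)
     (W n [k + 1, k + 1] - 2 * a * W n [k + 1, k] + a\<^sup>2 * W n [k, k]
      - 2 * c * W n [k + 1] + 2 * c * a * W n [k] + c\<^sup>2)"
    proof (intro has_bochner_integral_add has_bochner_integral_diff has_bochner_integral_mult_right)
      show "has_bochner_integral (G n) (\<lambda>x. c\<^sup>2) (c\<^sup>2)"
        using has_bochner_integral_integrable[of "G n" "\<lambda>x. c\<^sup>2"] by (simp add: prob_space)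
    qed (use has_bochner_integral_integrable[OF integrable_power_mean[OF n]]
           has_bochner_integral_integrable[OF integrable_power_mean_mult[OF n]]
         in \<open>simp_all only: integral_power_mean integral_power_mean_mult\<close>)
    ultimately show "(\<integral>x. (X n x - c)\<^sup>2 \<partial>G n) = W n [k + 1, k + 1] - 2 * a * W n [k + 1, k] + a\<^sup>2 * W n [k, k]
      - 2 * c * W n [k + 1] + 2 * c * a * W n [k] + c\<^sup>2" "integrable (G n) (\<lambda>x. (X n x - c)\<^sup>2)"
      by (auto simp: has_bochner_integral_iff)
  qed
  have "(\<lambda>n. (W n [k + 1, k + 1] - 2 * a * W n [k + 1, k] + a\<^sup>2 * W n [k, k]
      - 2 * c * W n [k + 1] + 2 * c * a * W n [k] + c\<^sup>2) / c\<^sup>2) \<longlonglongrightarrow>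
     (catalan (k + 2) * catalan (k + 2) - 2 * a * (catalan (k + 2) * catalan (k + 1)) + a\<^sup>2 * (catalan (k + 1) * catalan (k + 1))
      - 2 * c * catalan (k + 2) + 2 * c * a * catalan (k + 1) + c\<^sup>2) / c\<^sup>2"
    using W_tendsto[of "[k + 1, k + 1]"] W_tendsto[of "[k + 1, k]"] W_tendsto[of "[k, k]"] W_tendsto[of "[k + 1]"] W_tendsto[of "[k]"] c
    by (intro tendsto_divide tendsto_add tendsto_diff tendsto_mult tendsto_const) simp_all
  also have "catalan (k + 2) * catalan (k + 2) - 2 * a * (catalan (k + 2) * catalan (k + 1)) + a\<^sup>2 * (catalan (k + 1) * catalan (k + 1))
      - 2 * c * catalan (k + 2) + 2 * c * a * catalan (k + 1) + c\<^sup>2 = (catalan (k + 2) - a * catalan (k + 1) - c)\<^sup>2"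
    by (simp add: power2_eq_square algebra_simps)
  also have "\<dots> / c\<^sup>2 = 0" by (simp add: c_def)
  finally have lim: "(\<lambda>n. (W n [k + 1, k + 1] - 2 * a * W n [k + 1, k] + a\<^sup>2 * W n [k, k]
      - 2 * c * W n [k + 1] + 2 * c * a * W n [k] + c\<^sup>2) / c\<^sup>2) \<longlonglongrightarrow> 0" .
  have "eventually (\<lambda>n. measure (G n) {x \<in> space (G n). \<forall>i\<in>{1..n}. x i < 2 - \<epsilon>} \<le>
     (W n [k + 1, k + 1] - 2 * a * W n [k + 1, k] + a\<^sup>2 * W n [k, k]
      - 2 * c * W n [k + 1] + 2 * c * a * W n [k] + c\<^sup>2) / c\<^sup>2) sequentially"
    using eventually_ge_at_top[of 1]
  proof eventually_elim
    case (elim n)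
    interpret prob_space "G n" by (rule prob_gbe[OF elim])
    have sets: "{x \<in> space (G n). (X n x - c)\<^sup>2 \<ge> c\<^sup>2} \<in> sets (G n)"
      unfolding X_def by measurable
    have "{x \<in> space (G n). \<forall>i\<in>{1..n}. x i < 2 - \<epsilon>} \<subseteq> {x \<in> space (G n). (X n x - c)\<^sup>2 \<ge> c\<^sup>2}"
    proof safe
      fix x :: "nat \<Rightarrow> real" assume x: "\<forall>i\<in>{1..n}. x i < 2 - \<epsilon>"
      have "X n x = (\<Sum>i\<in>{1..n}. (x i + 2) ^ k * ((x i + 2) - a)) / real n"
      proof -
        have "(\<Sum>i\<in>{1..n}. (x i + 2) ^ k * ((x i + 2) - a)) = (\<Sum>i\<in>{1..n}. (x i + 2) ^ (k + 1)) - a * (\<Sum>i\<in>{1..n}. (x i + 2) ^ k)"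
          unfolding sum_distrib_left sum_subtractf[symmetric] by (intro sum.cong refl) (simp add: algebra_simps)
        then show ?thesis by (simp add: X_def power_mean_def diff_divide_distrib)
      qed
      also have "\<dots> \<le> 0"
      proof -
        have "(x i + 2) ^ k * ((x i + 2) - a) \<le> 0" if "i \<in> {1..n}" for i
          using bspec[OF x that] by (intro mult_nonneg_nonpos) (auto simp: k_def a_def)
        then show ?thesis by (intro divide_nonpos_nonneg sum_nonpos) auto
      qed
      finally have "X n x \<le> 0" .
      then have "c\<^sup>2 \<le> (c - X n x)\<^sup>2" using c by (intro power_mono) auto
      then show "c\<^sup>2 \<le> (X n x - c)\<^sup>2" by (simp add: power2_commute)
    qed
    then have "measure (G n) {x \<in> space (G n). \<forall>i\<in>{1..n}. x i < 2 - \<epsilon>} \<le> measure (G n) {x \<in> space (G n). (X n x - c)\<^sup>2 \<ge> c\<^sup>2}"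
      by (intro finite_measure_mono sets)
    also have "\<dots> \<le> (\<integral>x. (X n x - c)\<^sup>2 \<partial>G n) / c\<^sup>2"
      using c by (intro integral_Markov_inequality_measure[OF int[OF elim] sets]) auto
    finally show ?case by (simp only: second[OF elim])
  qed
  then show ?thesis
    by (intro tendsto_sandwich[OF _ _ tendsto_const lim]) auto
qed

end

theorem corollary1p2:
  fixes \<beta> \<alpha> :: "nat \<Rightarrow> real"
    and M :: "nat \<Rightarrow> 'a measure"
    and \<Lambda> :: "nat \<Rightarrow> 'a \<Rightarrow> nat \<Rightarrow> real"
  assumes "\<And>n. n \<ge> 1 \<Longrightarrow> \<beta> n > 0"
    and "(\<lambda>n. ln (real n) / real n) \<lless> \<beta>"
    and "\<beta> \<lless> (\<lambda>n. 1 / ln (real n))"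
    and "\<And>n. n \<ge> 1 \<Longrightarrow> \<alpha> n = real n * \<beta> n / 2"
    and "\<And>n. n \<ge> 1 \<Longrightarrow> prob_space (M n)"
    and "\<And>n. n \<ge> 1 \<Longrightarrow> \<Lambda> n \<in> M n \<rightarrow>\<^sub>M euclid n"
    and "\<And>n. n \<ge> 1 \<Longrightarrow> distr (M n) (euclid n) (\<Lambda> n) = gbe n (\<alpha> n) (\<beta> n)"
  shows "tendsto_in_prob M (\<lambda>n \<omega>. Max (\<Lambda> n \<omega> ` {1..n})) 2"
proof -
  \<comment> \<open>As the law of a random vector, the ensemble has total mass one; in particular its normalising
    constant is not the default value \<open>0\<close> of a divergent integral.\<close>
  interpret vanishing_beta_ensemble \<alpha> \<beta>
  proof (rule vanishing_beta_ensemble.intro)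
    show "prob_space (gbe n (\<alpha> n) (\<beta> n))" if "n \<ge> 1" for n
      using prob_space.prob_space_distr[OF assms(5)[OF that] assms(6)[OF that]] assms(7)[OF that] by simp
  qed (fact assms(1-4))+
  show ?thesis
    unfolding tendsto_in_prob_def
  proof (intro allI impI)
    fix \<epsilon> :: real assume \<epsilon>: "\<epsilon> > 0"
    define U where "U n = {x \<in> space (G n). \<exists>i\<in>{1..n}. x i > 2 + \<epsilon>}" for n
    define L where "L n = {x \<in> space (G n). \<forall>i\<in>{1..n}. x i < 2 - \<epsilon>}" for n
    have "(\<lambda>n. measure (G n) (U n) + measure (G n) (L n)) \<longlonglongrightarrow> 0 + 0"
      unfolding U_def L_def by (intro tendsto_add upper_tail lower_tail \<epsilon>)
    then have lim: "(\<lambda>n. measure (G n) (U n) + measure (G n) (L n)) \<longlonglongrightarrow> 0" by simp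
    have "eventually (\<lambda>n. measure (M n) {\<omega> \<in> space (M n). \<bar>Max (\<Lambda> n \<omega> ` {1..n}) - 2\<bar> > \<epsilon>}
        \<le> measure (G n) (U n) + measure (G n) (L n)) sequentially"
      using eventually_ge_at_top[of 1]
    proof eventually_elim
      case (elim n)
      interpret prob_space "M n" by (rule assms(5)[OF elim])
      note \<Lambda> = assms(6)[OF elim] and distr = assms(7)[OF elim]
      have coord: "(\<lambda>x. x i) \<in> borel_measurable (G n)" if "i \<in> {1..n}" for i
        using measurable_coord[OF that] by (simp cong: measurable_cong_sets)
      have sets: "U n \<in> sets (euclid n)" "L n \<in> sets (euclid n)"
        unfolding sets_gbe[symmetric, of n "\<alpha> n" "\<beta> n"] U_def L_def using coord by measurable
      let ?pre = "\<lambda>A. \<Lambda> n -` A \<inter> space (M n)"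
      have pre: "?pre A \<in> sets (M n)" "measure (M n) (?pre A) = measure (G n) A" if "A \<in> sets (euclid n)" for A
        using measurable_sets[OF \<Lambda> that] measure_distr[OF \<Lambda> that] distr by auto
      have "{\<omega> \<in> space (M n). \<bar>Max (\<Lambda> n \<omega> ` {1..n}) - 2\<bar> > \<epsilon>} \<subseteq> ?pre (U n) \<union> ?pre (L n)"
      proof
        fix \<omega> assume "\<omega> \<in> {\<omega> \<in> space (M n). \<bar>Max (\<Lambda> n \<omega> ` {1..n}) - 2\<bar> > \<epsilon>}"
        then have \<omega>: "\<omega> \<in> space (M n)" and dev: "\<bar>Max (\<Lambda> n \<omega> ` {1..n}) - 2\<bar> > \<epsilon>" by auto
        have space: "\<Lambda> n \<omega> \<in> space (G n)"
          using measurable_space[OF \<Lambda> \<omega>] by (simp add: space_gbe)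
        have fin: "finite (\<Lambda> n \<omega> ` {1..n})" and ne: "\<Lambda> n \<omega> ` {1..n} \<noteq> {}" using elim by auto
        show "\<omega> \<in> ?pre (U n) \<union> ?pre (L n)"
        proof (cases "Max (\<Lambda> n \<omega> ` {1..n}) > 2 + \<epsilon>")
          case True
          then have "\<exists>i\<in>{1..n}. \<Lambda> n \<omega> i > 2 + \<epsilon>" using Max_gr_iff[OF fin ne] by auto
          then show ?thesis using \<omega> space by (auto simp: U_def)
        next
          case False
          then have "Max (\<Lambda> n \<omega> ` {1..n}) < 2 - \<epsilon>" using dev by linarith
          then have "\<forall>i\<in>{1..n}. \<Lambda> n \<omega> i < 2 - \<epsilon>" using Max_less_iff[OF fin ne] by auto
          then show ?thesis using \<omega> space by (auto simp: L_def)
        qed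
      qed
      then have "measure (M n) {\<omega> \<in> space (M n). \<bar>Max (\<Lambda> n \<omega> ` {1..n}) - 2\<bar> > \<epsilon>} \<le> measure (M n) (?pre (U n) \<union> ?pre (L n))"
        using pre(1)[OF sets(1)] pre(1)[OF sets(2)] by (intro finite_measure_mono) auto
      also have "\<dots> \<le> measure (M n) (?pre (U n)) + measure (M n) (?pre (L n))"
        by (intro measure_Un_le pre sets)
      also have "\<dots> = measure (G n) (U n) + measure (G n) (L n)"
        by (simp only: pre(2)[OF sets(1)] pre(2)[OF sets(2)])
      finally show ?case .
    qed
    then show "(\<lambda>n. measure (M n) {\<omega> \<in> space (M n). \<bar>Max (\<Lambda> n \<omega> ` {1..n}) - 2\<bar> > \<epsilon>}) \<longlonglongrightarrow> 0"
      by (intro tendsto_sandwich[OF _ _ tendsto_const lim]) auto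
  qed
qed

end
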